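(* Let $\mathcal{U}=\begin{bmatrix}\mathcal{A}&\mathcal{M}\\ \mathcal{N}&\mathcal{B}\end{bmatrix}$ be a unital generalized matrix algebra satisfying $$a\in\mathcal{A},\ a\mathcal{M}=0\ \text{ and }\ \mathcal{N}a=0\ \Rightarrow\ a=0,$$ $$b\in\mathcal{B},\ \mathcal{M}b=0\ \text{ and }\ b\mathcal{N}=0\ \Rightarrow\ b=0.$$ Suppose that (i) $\pi_{\mathcal{B}}(Z(\mathcal{U}))=Z(\mathcal{B})$ or $[[\mathcal{A},\mathcal{A}],\mathcal{A}]=\mathcal{A}$; and (ii) $\pi_{\mathcal{A}}(Z(\mathcal{U}))=Z(\mathcal{A})$ or $[[\mathcal{B},\mathcal{B}],\mathcal{B}]=\mathcal{B}$. Then a linear mapping $\phi:\mathcal{U}\to\mathcal{U}$ is a Lie triple centralizer if and only if $\phi$ is a proper Lie triple centralizer.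
   Context: All algebras (associative) and modules are over a unital commutative ring $\mathcal{R}$, and linear means $\mathcal{R}$-linear. $[x,y]=xy-yx$, and $Z(\mathcal{G})$ is the center of an algebra $\mathcal{G}$. $[[\mathcal{G},\mathcal{G}],\mathcal{G}]$ is the $\mathcal{R}$-submodule of $\mathcal{G}$ spanned by all $[[x,y],z]$ with $x,y,z\in\mathcal{G}$. A Morita context consists of algebras $\mathcal{A},\mathcal{B}$, an $(\mathcal{A},\mathcal{B})$-bimodule $\mathcal{M}$, a $(\mathcal{B},\mathcal{A})$-bimodule $\mathcal{N}$, and bimodule homomorphisms $\mathcal{M}\otimes_{\mathcal{B}}\mathcal{N}\to\mathcal{A}$, $m\otimes n\mapsto mn$, and $\mathcal{N}\otimes_{\mathcal{A}}\mathcal{M}\to\mathcal{B}$, $n\otimes m\mapsto nm$, satisfying $(mn)m'=m(nm')$ and $(nm)n'=n(mn')$ for all $m,m'\in\mathcal{M}$, $n,n'\in\mathcal{N}$. The set $\mathcal{U}=\begin{bmatrix}\mathcal{A}&\mathcal{M}\\ \mathcal{N}&\mathcal{B}\end{bmatrix}$ of all matrices $\begin{bmatrix}a&m\\ n&b\end{bmatrix}$ ($a\in\mathcal{A}$, $m\in\mathcal{M}$, $n\in\mathcal{N}$, $b\in\mathcal{B}$), with the usual matrix operations, is an algebra called a generalized matrix algebra. It is unital exactly when $\mathcal{A},\mathcal{B}$ are unital with identities $1_{\mathcal{A}},1_{\mathcal{B}}$ and $\mathcal{M},\mathcal{N}$ are unital bimodules ($1_{\mathcal{A}}m=m=m1_{\mathcal{B}}$,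 $1_{\mathcal{B}}n=n=n1_{\mathcal{A}}$). The projections $\pi_{\mathcal{A}}:\mathcal{U}\to\mathcal{A}$ and $\pi_{\mathcal{B}}:\mathcal{U}\to\mathcal{B}$ send $\begin{bmatrix}a&m\\ n&b\end{bmatrix}$ to $a$ and $b$, respectively. A linear map $\phi:\mathcal{G}\to\mathcal{G}$ on an algebra $\mathcal{G}$ is a Lie triple centralizer if $\phi([[a,b],c])=[[\phi(a),b],c]$ for all $a,b,c\in\mathcal{G}$. It is a proper Lie triple centralizer if there are $\lambda\in Z(\mathcal{G})$ and a linear map $\chi:\mathcal{G}\to Z(\mathcal{G})$ with $\chi([[a,b],c])=0$ for all $a,b,c\in\mathcal{G}$ such that $\phi(a)=\lambda a+\chi(a)$ for all $a\in\mathcal{G}$. *)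

theory Defs
  imports "HOL-Algebra.Module"
begin

text \<open>The library locale for algebras assumes commutativity, so unital associative algebras over a
  commutative ring are introduced here. They need not be nontrivial.\<close>

locale unital_algebra = module R G + ring G for R (structure) and G (structure) +
  assumes smult_mult_left:
      "\<lbrakk>r \<in> carrier R; x \<in> carrier G; y \<in> carrier G\<rbrakk> \<Longrightarrow>
        (r \<odot>\<^bsub>G\<^esub> x) \<otimes>\<^bsub>G\<^esub> y = r \<odot>\<^bsub>G\<^esub> (x \<otimes>\<^bsub>G\<^esub> y)"
    and smult_mult_right:
      "\<lbrakk>r \<in> carrier R; x \<in> carrier G; y \<in> carrier G\<rbrakk> \<Longrightarrow>
        x \<otimes>\<^bsub>G\<^esub> (r \<odot>\<^bsub>G\<^esub> y) = r \<odot>\<^bsub>G\<^esub> (x \<otimes>\<^bsub>G\<^esub> y)"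

definition linear_map ::
    "('r, 'x) ring_scheme \<Rightarrow> ('r, 'g, 'y) module_scheme \<Rightarrow> ('r, 'h, 'z) module_scheme \<Rightarrow> ('g \<Rightarrow> 'h) \<Rightarrow> bool"
  where "linear_map R G H f \<longleftrightarrow>
    f \<in> carrier G \<rightarrow> carrier H \<and>
    (\<forall>x\<in>carrier G. \<forall>y\<in>carrier G. f (x \<oplus>\<^bsub>G\<^esub> y) = f x \<oplus>\<^bsub>H\<^esub> f y) \<and>
    (\<forall>r\<in>carrier R. \<forall>x\<in>carrier G. f (r \<odot>\<^bsub>G\<^esub> x) = r \<odot>\<^bsub>H\<^esub> f x)"

definition lie_bracket :: "('g, 'z) ring_scheme \<Rightarrow> 'g \<Rightarrow> 'g \<Rightarrow> 'g"
  where "lie_bracket G x y = (x \<otimes>\<^bsub>G\<^esub> y) \<ominus>\<^bsub>G\<^esub> (y \<otimes>\<^bsub>G\<^esub> x)"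

definition center :: "('g, 'z) ring_scheme \<Rightarrow> 'g set"
  where "center G = {z \<in> carrier G. \<forall>x\<in>carrier G. z \<otimes>\<^bsub>G\<^esub> x = x \<otimes>\<^bsub>G\<^esub> z}"

definition triple_commutators :: "('r, 'x) ring_scheme \<Rightarrow> ('r, 'g, 'z) module_scheme \<Rightarrow> 'g set"
  where "triple_commutators R G =
    \<Inter>{H. submodule H R G \<and>
      {lie_bracket G (lie_bracket G x y) z | x y z. x \<in> carrier G \<and> y \<in> carrier G \<and> z \<in> carrier G} \<subseteq> H}"

definition lie_triple_centralizer ::
    "('r, 'x) ring_scheme \<Rightarrow> ('r, 'g, 'z) module_scheme \<Rightarrow> ('g \<Rightarrow> 'g) \<Rightarrow> bool"
  where "lie_triple_centralizer R G \<phi> \<longleftrightarrow>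
    linear_map R G G \<phi> \<and>
    (\<forall>a\<in>carrier G. \<forall>b\<in>carrier G. \<forall>c\<in>carrier G.
      \<phi> (lie_bracket G (lie_bracket G a b) c) = lie_bracket G (lie_bracket G (\<phi> a) b) c)"

definition proper_lie_triple_centralizer ::
    "('r, 'x) ring_scheme \<Rightarrow> ('r, 'g, 'z) module_scheme \<Rightarrow> ('g \<Rightarrow> 'g) \<Rightarrow> bool"
  where "proper_lie_triple_centralizer R G \<phi> \<longleftrightarrow>
    linear_map R G G \<phi> \<and>
    (\<exists>l\<in>center G. \<exists>\<chi>.
      linear_map R G G \<chi> \<and> \<chi> \<in> carrier G \<rightarrow> center G \<and>
      (\<forall>a\<in>carrier G. \<forall>b\<in>carrier G. \<forall>c\<in>carrier G.
        \<chi> (lie_bracket G (lie_bracket G a b) c) = \<zero>\<^bsub>G\<^esub>) \<and>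
      (\<forall>a\<in>carrier G. \<phi> a = (l \<otimes>\<^bsub>G\<^esub> a) \<oplus>\<^bsub>G\<^esub> \<chi> a))"

text \<open>As for modules, the multiplicative fields inherited from the ring record carry no meaning in a
  bimodule; \<open>lact M a m\<close> is $am$ and \<open>ract M m b\<close> is $mb$.\<close>

record ('r, 'm, 'a, 'b) bimodule = "('r, 'm) module" +
  lact :: "'a \<Rightarrow> 'm \<Rightarrow> 'm"
  ract :: "'m \<Rightarrow> 'b \<Rightarrow> 'm"

locale unital_bimodule =
  A: unital_algebra R A + B: unital_algebra R B + M: module R M
  for R :: "('r, 'x) ring_scheme"
    and A :: "('r, 'a, 'y) module_scheme"
    and B :: "('r, 'b, 'z) module_scheme"
    and M :: "('r, 'm, 'a, 'b, 'w) bimodule_scheme" +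
  assumes lact_closed: "\<lbrakk>a \<in> carrier A; m \<in> carrier M\<rbrakk> \<Longrightarrow> lact M a m \<in> carrier M"
    and ract_closed: "\<lbrakk>m \<in> carrier M; b \<in> carrier B\<rbrakk> \<Longrightarrow> ract M m b \<in> carrier M"
    and lact_add_left: "\<lbrakk>a \<in> carrier A; a' \<in> carrier A; m \<in> carrier M\<rbrakk> \<Longrightarrow>
        lact M (a \<oplus>\<^bsub>A\<^esub> a') m = lact M a m \<oplus>\<^bsub>M\<^esub> lact M a' m"
    and lact_add_right: "\<lbrakk>a \<in> carrier A; m \<in> carrier M; m' \<in> carrier M\<rbrakk> \<Longrightarrow>
        lact M a (m \<oplus>\<^bsub>M\<^esub> m') = lact M a m \<oplus>\<^bsub>M\<^esub> lact M a m'"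
    and ract_add_left: "\<lbrakk>m \<in> carrier M; m' \<in> carrier M; b \<in> carrier B\<rbrakk> \<Longrightarrow>
        ract M (m \<oplus>\<^bsub>M\<^esub> m') b = ract M m b \<oplus>\<^bsub>M\<^esub> ract M m' b"
    and ract_add_right: "\<lbrakk>m \<in> carrier M; b \<in> carrier B; b' \<in> carrier B\<rbrakk> \<Longrightarrow>
        ract M m (b \<oplus>\<^bsub>B\<^esub> b') = ract M m b \<oplus>\<^bsub>M\<^esub> ract M m b'"
    and lact_smult_left: "\<lbrakk>r \<in> carrier R; a \<in> carrier A; m \<in> carrier M\<rbrakk> \<Longrightarrow>
        lact M (r \<odot>\<^bsub>A\<^esub> a) m = r \<odot>\<^bsub>M\<^esub> lact M a m"
    and lact_smult_right: "\<lbrakk>r \<in> carrier R; a \<in> carrier A; m \<in> carrier M\<rbrakk> \<Longrightarrow>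
        lact M a (r \<odot>\<^bsub>M\<^esub> m) = r \<odot>\<^bsub>M\<^esub> lact M a m"
    and ract_smult_left: "\<lbrakk>r \<in> carrier R; m \<in> carrier M; b \<in> carrier B\<rbrakk> \<Longrightarrow>
        ract M (r \<odot>\<^bsub>M\<^esub> m) b = r \<odot>\<^bsub>M\<^esub> ract M m b"
    and ract_smult_right: "\<lbrakk>r \<in> carrier R; m \<in> carrier M; b \<in> carrier B\<rbrakk> \<Longrightarrow>
        ract M m (r \<odot>\<^bsub>B\<^esub> b) = r \<odot>\<^bsub>M\<^esub> ract M m b"
    and lact_mult: "\<lbrakk>a \<in> carrier A; a' \<in> carrier A; m \<in> carrier M\<rbrakk> \<Longrightarrow>
        lact M (a \<otimes>\<^bsub>A\<^esub> a') m = lact M a (lact M a' m)"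
    and ract_mult: "\<lbrakk>m \<in> carrier M; b \<in> carrier B; b' \<in> carrier B\<rbrakk> \<Longrightarrow>
        ract M m (b \<otimes>\<^bsub>B\<^esub> b') = ract M (ract M m b) b'"
    and lact_ract: "\<lbrakk>a \<in> carrier A; m \<in> carrier M; b \<in> carrier B\<rbrakk> \<Longrightarrow>
        ract M (lact M a m) b = lact M a (ract M m b)"
    and lact_one: "m \<in> carrier M \<Longrightarrow> lact M \<one>\<^bsub>A\<^esub> m = m"
    and ract_one: "m \<in> carrier M \<Longrightarrow> ract M m \<one>\<^bsub>B\<^esub> = m"

text \<open>A homomorphism of bimodules from the tensor product of \<open>M\<close> and \<open>N\<close> over \<open>B\<close> to \<open>A\<close> is given,
  through the universal property, by the \<open>B\<close>-balanced \<open>R\<close>-bilinear map \<open>p\<close> sending $(m,n)$ to the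
  image of $m \otimes n$, which is \<open>A\<close>-linear on both sides.\<close>

definition balanced_pairing ::
    "('r, 'x) ring_scheme \<Rightarrow> ('r, 'a, 'y) module_scheme \<Rightarrow> ('r, 'b, 'z) module_scheme \<Rightarrow>
     ('r, 'm, 'a, 'b, 'v) bimodule_scheme \<Rightarrow> ('r, 'n, 'b, 'a, 'w) bimodule_scheme \<Rightarrow>
     ('m \<Rightarrow> 'n \<Rightarrow> 'a) \<Rightarrow> bool"
  where "balanced_pairing R A B M N p \<longleftrightarrow>
    (\<forall>m\<in>carrier M. linear_map R N A (p m)) \<and>
    (\<forall>n\<in>carrier N. linear_map R M A (\<lambda>m. p m n)) \<and>
    (\<forall>m\<in>carrier M. \<forall>b\<in>carrier B. \<forall>n\<in>carrier N. p (ract M m b) n = p m (lact N b n)) \<and>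
    (\<forall>a\<in>carrier A. \<forall>m\<in>carrier M. \<forall>n\<in>carrier N. p (lact M a m) n = a \<otimes>\<^bsub>A\<^esub> p m n) \<and>
    (\<forall>a\<in>carrier A. \<forall>m\<in>carrier M. \<forall>n\<in>carrier N. p m (ract N n a) = p m n \<otimes>\<^bsub>A\<^esub> a)"

locale unital_morita_context =
  M: unital_bimodule R A B M + N: unital_bimodule R B A N
  for R :: "('r, 'x) ring_scheme"
    and A :: "('r, 'a, 'y) module_scheme"
    and B :: "('r, 'b, 'z) module_scheme"
    and M :: "('r, 'm, 'a, 'b, 'v) bimodule_scheme"
    and N :: "('r, 'n, 'b, 'a, 'w) bimodule_scheme" +
  fixes mn :: "'m \<Rightarrow> 'n \<Rightarrow> 'a"
    and nm :: "'n \<Rightarrow> 'm \<Rightarrow> 'b"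
  assumes mn_pairing: "balanced_pairing R A B M N mn"
    and nm_pairing: "balanced_pairing R B A N M nm"
    and mn_m: "\<lbrakk>m \<in> carrier M; n \<in> carrier N; m' \<in> carrier M\<rbrakk> \<Longrightarrow>
        lact M (mn m n) m' = ract M m (nm n m')"
    and nm_n: "\<lbrakk>n \<in> carrier N; m \<in> carrier M; n' \<in> carrier N\<rbrakk> \<Longrightarrow>
        lact N (nm n m) n' = ract N n (mn m n')"

text \<open>\<open>GMat a m n b\<close> is the matrix with first row $(a, m)$ and second row $(n, b)$.\<close>

datatype ('a, 'm, 'n, 'b) gmat = GMat (piA: 'a) (entryM: 'm) (entryN: 'n) (piB: 'b)

definition gen_matrix_algebra ::
    "('r, 'a, 'y) module_scheme \<Rightarrow> ('r, 'b, 'z) module_scheme \<Rightarrow>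
     ('r, 'm, 'a, 'b, 'v) bimodule_scheme \<Rightarrow> ('r, 'n, 'b, 'a, 'w) bimodule_scheme \<Rightarrow>
     ('m \<Rightarrow> 'n \<Rightarrow> 'a) \<Rightarrow> ('n \<Rightarrow> 'm \<Rightarrow> 'b) \<Rightarrow> ('r, ('a, 'm, 'n, 'b) gmat) module"
  where "gen_matrix_algebra A B M N mn nm =
    \<lparr>carrier = {GMat a m n b | a m n b.
        a \<in> carrier A \<and> m \<in> carrier M \<and> n \<in> carrier N \<and> b \<in> carrier B},
     mult = (\<lambda>x y. GMat
        (piA x \<otimes>\<^bsub>A\<^esub> piA y \<oplus>\<^bsub>A\<^esub> mn (entryM x) (entryN y))
        (lact M (piA x) (entryM y) \<oplus>\<^bsub>M\<^esub> ract M (entryM x) (piB y))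
        (ract N (entryN x) (piA y) \<oplus>\<^bsub>N\<^esub> lact N (piB x) (entryN y))
        (nm (entryN x) (entryM y) \<oplus>\<^bsub>B\<^esub> piB x \<otimes>\<^bsub>B\<^esub> piB y)),
     one = GMat \<one>\<^bsub>A\<^esub> \<zero>\<^bsub>M\<^esub> \<zero>\<^bsub>N\<^esub> \<one>\<^bsub>B\<^esub>,
     zero = GMat \<zero>\<^bsub>A\<^esub> \<zero>\<^bsub>M\<^esub> \<zero>\<^bsub>N\<^esub> \<zero>\<^bsub>B\<^esub>,
     add = (\<lambda>x y. GMat
        (piA x \<oplus>\<^bsub>A\<^esub> piA y) (entryM x \<oplus>\<^bsub>M\<^esub> entryM y)
        (entryN x \<oplus>\<^bsub>N\<^esub> entryN y) (piB x \<oplus>\<^bsub>B\<^esub> piB y)),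
     smult = (\<lambda>r x. GMat
        (r \<odot>\<^bsub>A\<^esub> piA x) (r \<odot>\<^bsub>M\<^esub> entryM x) (r \<odot>\<^bsub>N\<^esub> entryN x) (r \<odot>\<^bsub>B\<^esub> piB x))\<rparr>"

end

theory Submission
  imports Defs
begin

text \<open>
  Write $e$ and $f = 1 - e$ for the two diagonal idempotents of the matrix algebra $G$, so that the
  four entries become the Peirce blocks $eGe$, $eGf$, $fGe$, $fGf$. Everything that matters about the
  Morita context is expressible by these blocks, and the setting is symmetric under exchanging $e$
  and $f$; the argument is therefore carried out for an algebra with a pair of complementary
  idempotents, each half being proved once and transported by the exchange.

  Let $\phi$ be a Lie triple centralizer. If $x$ and $y$ commute, then $[[\phi(x),y],z] = 0$ for all
  $z$, so that $[\phi(x),y]$ is central (\<open>commute_imp_central_bracket\<close>). The faithfulness hypotheses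
  leave no nonzero central element inside a single block (\<open>central_block_zero\<close>,
  \<open>central_off_diagonal_zero\<close>). Playing these against each other shows that $\phi$ maps diagonal
  elements to diagonal ones, that $\phi(1)$ is central, and that for $a \in eGe$ the far corner
  $f\phi(a)$ lies in the center of $fGf$. Each alternative of the first condition now says that this
  far corner is the far corner of some $z_a \in Z(G)$: either every central element of $fGf$ is one,
  or $eGe$ is spanned by triple commutators and the far corner vanishes
  (\<open>far_corner_zero\<close>). Likewise $e\phi(b) = e z_b$ for $b \in fGf$.

  For $m \in eGf$ one has $am = [[a,m],f]$ and hence $\phi(am) = \phi(a)m - m\phi(a) = (\phi(a) - z_a)m$;
  similarly $\phi(na) = n(\phi(a) - z_a)$ for $n \in fGe$. Taking $a = e$ shows that $\phi$ is
  multiplication by the central element $\lambda = \phi(1) - z_e - z_f$ on the off-diagonal blocks. For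
  general $a$ one then gets $(\phi(a) - z_a - \lambda a)m = 0 = n(\phi(a) - z_a - \lambda a)$, and
  faithfulness yields $\phi(a) = \lambda a + z_a$. So $\phi - \lambda$ takes central values on every
  block, and it then kills triple commutators because central summands drop out of brackets; the same
  remark gives the converse.
\<close>

section \<open>Linear maps, centers and Lie brackets\<close>

lemma linear_map_closed: "\<lbrakk>linear_map R G H h; x \<in> carrier G\<rbrakk> \<Longrightarrow> h x \<in> carrier H"
  by (auto simp: linear_map_def)

lemma linear_map_add:
  "\<lbrakk>linear_map R G H h; x \<in> carrier G; y \<in> carrier G\<rbrakk> \<Longrightarrow> h (x \<oplus>\<^bsub>G\<^esub> y) = h x \<oplus>\<^bsub>H\<^esub> h y"
  by (simp add: linear_map_def)

lemma linear_map_smult: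
  "\<lbrakk>linear_map R G H h; r \<in> carrier R; x \<in> carrier G\<rbrakk> \<Longrightarrow> h (r \<odot>\<^bsub>G\<^esub> x) = r \<odot>\<^bsub>H\<^esub> h x"
  by (simp add: linear_map_def)

lemma linear_map_zero:
  assumes "linear_map R G H h" "abelian_group G" "abelian_group H"
  shows "h \<zero>\<^bsub>G\<^esub> = \<zero>\<^bsub>H\<^esub>"
proof -
  interpret G: abelian_group G by fact
  interpret H: abelian_group H by fact
  show ?thesis
    using linear_map_add[OF assms(1), of "\<zero>\<^bsub>G\<^esub>" "\<zero>\<^bsub>G\<^esub>"] linear_map_closed[OF assms(1), of "\<zero>\<^bsub>G\<^esub>"]
    by simp
qed

lemma linear_map_minus:
  assumes "linear_map R G H h" "abelian_group G" "abelian_group H" and x: "x \<in> carrier G"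
  shows "h (\<ominus>\<^bsub>G\<^esub> x) = \<ominus>\<^bsub>H\<^esub> h x"
proof -
  interpret G: abelian_group G by fact
  interpret H: abelian_group H by fact
  have "h (\<ominus>\<^bsub>G\<^esub> x) \<oplus>\<^bsub>H\<^esub> h x = \<zero>\<^bsub>H\<^esub>"
    using x linear_map_add[OF assms(1), of "\<ominus>\<^bsub>G\<^esub> x" x] linear_map_zero[OF assms(1-3)]
    by (simp add: G.l_neg)
  then show ?thesis
    using x linear_map_closed[OF assms(1)] by (simp add: H.minus_equality)
qed

context ring
begin

lemma center_iff: "z \<in> center R \<longleftrightarrow> z \<in> carrier R \<and> (\<forall>x\<in>carrier R. z \<otimes> x = x \<otimes> z)"
  by (simp add: center_def)

lemma center_closed: "z \<in> center R \<Longrightarrow> z \<in> carrier R"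
  by (simp add: center_def)

lemma center_commute: "\<lbrakk>z \<in> center R; x \<in> carrier R\<rbrakk> \<Longrightarrow> z \<otimes> x = x \<otimes> z"
  by (simp add: center_def)

lemma zero_center: "\<zero> \<in> center R"
  by (simp add: center_def)

lemma add_center: "\<lbrakk>z \<in> center R; w \<in> center R\<rbrakk> \<Longrightarrow> z \<oplus> w \<in> center R"
  by (simp add: center_def l_distr r_distr)

lemma diff_center: "\<lbrakk>z \<in> center R; w \<in> center R\<rbrakk> \<Longrightarrow> z \<ominus> w \<in> center R"
  by (simp add: center_def minus_eq l_distr r_distr l_minus r_minus)

lemma bracket_closed:
  "\<lbrakk>x \<in> carrier R; y \<in> carrier R\<rbrakk> \<Longrightarrow> lie_bracket R x y \<in> carrier R"
  by (simp add: lie_bracket_def)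

lemma bracket_zero_left: "x \<in> carrier R \<Longrightarrow> lie_bracket R \<zero> x = \<zero>"
  by (simp add: lie_bracket_def minus_eq)

lemma diff_zero_iff:
  assumes "x \<in> carrier R" "y \<in> carrier R"
  shows "x \<ominus> y = \<zero> \<longleftrightarrow> x = y"
  using assms by (metis add.inv_closed minus_eq minus_equality minus_minus r_neg)

lemma bracket_eq_zero_iff:
  assumes "x \<in> carrier R" "y \<in> carrier R"
  shows "lie_bracket R x y = \<zero> \<longleftrightarrow> x \<otimes> y = y \<otimes> x"
  using assms by (simp add: lie_bracket_def diff_zero_iff)

lemma center_iff_bracket:
  assumes "z \<in> carrier R"
  shows "z \<in> center R \<longleftrightarrow> (\<forall>x\<in>carrier R. lie_bracket R z x = \<zero>)"
  using assms by (auto simp: center_iff bracket_eq_zero_iff)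

lemma bracket_add_left:
  assumes "x \<in> carrier R" "y \<in> carrier R" "c \<in> carrier R"
  shows "lie_bracket R (x \<oplus> y) c = lie_bracket R x c \<oplus> lie_bracket R y c"
  using assms unfolding lie_bracket_def by algebra

lemma bracket_central_left:
  assumes l: "l \<in> center R" and x: "x \<in> carrier R" and y: "y \<in> carrier R"
  shows "lie_bracket R (l \<otimes> x) y = l \<otimes> lie_bracket R x y"
proof -
  have "y \<otimes> (l \<otimes> x) = l \<otimes> (y \<otimes> x)"
    using assms center_commute[OF l y] center_closed[OF l] by (metis m_assoc)
  then show ?thesis
    using assms center_closed[OF l]
    by (simp add: lie_bracket_def minus_eq r_distr r_minus m_assoc)
qed

end

section \<open>Peirce decompositions\<close>

text \<open>For idempotent \<open>p\<close> and \<open>q\<close> this is $pGq$; describing it by fixed points makes membership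
  directly usable for rewriting.\<close>

definition peirce_block :: "('g, 'z) ring_scheme \<Rightarrow> 'g \<Rightarrow> 'g \<Rightarrow> 'g set"
  where "peirce_block G p q = {x \<in> carrier G. p \<otimes>\<^bsub>G\<^esub> x = x \<and> x \<otimes>\<^bsub>G\<^esub> q = x}"

text \<open>The last two assumptions are the faithfulness hypotheses on the Morita context.\<close>

locale peirce_decomposition = unital_algebra R G
  for R (structure) and G (structure) +
  fixes e f :: 'b
  assumes e_closed [simp]: "e \<in> carrier G" and f_closed [simp]: "f \<in> carrier G"
    and e_idem [simp]: "e \<otimes>\<^bsub>G\<^esub> e = e" and f_idem [simp]: "f \<otimes>\<^bsub>G\<^esub> f = f"
    and ef [simp]: "e \<otimes>\<^bsub>G\<^esub> f = \<zero>\<^bsub>G\<^esub>" and fe [simp]: "f \<otimes>\<^bsub>G\<^esub> e = \<zero>\<^bsub>G\<^esub>"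
    and e_plus_f: "e \<oplus>\<^bsub>G\<^esub> f = \<one>\<^bsub>G\<^esub>"
    and faithful_e: "\<lbrakk>x \<in> peirce_block G e e;
        \<forall>m\<in>peirce_block G e f. x \<otimes>\<^bsub>G\<^esub> m = \<zero>\<^bsub>G\<^esub>; \<forall>n\<in>peirce_block G f e. n \<otimes>\<^bsub>G\<^esub> x = \<zero>\<^bsub>G\<^esub>\<rbrakk>
        \<Longrightarrow> x = \<zero>\<^bsub>G\<^esub>"
    and faithful_f: "\<lbrakk>x \<in> peirce_block G f f;
        \<forall>m\<in>peirce_block G e f. m \<otimes>\<^bsub>G\<^esub> x = \<zero>\<^bsub>G\<^esub>; \<forall>n\<in>peirce_block G f e. x \<otimes>\<^bsub>G\<^esub> n = \<zero>\<^bsub>G\<^esub>\<rbrakk>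
        \<Longrightarrow> x = \<zero>\<^bsub>G\<^esub>"
begin

lemma peirce_swap: "peirce_decomposition R G f e"
proof (unfold_locales, goal_cases)
  case 7 show ?case using e_plus_f a_comm e_closed f_closed by metis
next
  case 8 then show ?case using faithful_f by blast
next
  case 9 then show ?case using faithful_e by blast
qed simp_all

lemma blockD:
  assumes "x \<in> peirce_block G p q"
  shows "x \<in> carrier G" "p \<otimes>\<^bsub>G\<^esub> x = x" "x \<otimes>\<^bsub>G\<^esub> q = x"
  using assms by (auto simp: peirce_block_def)

lemma left_absorb:
  assumes x: "x \<in> peirce_block G e q"
  shows "e \<otimes>\<^bsub>G\<^esub> x = x" "f \<otimes>\<^bsub>G\<^esub> x = \<zero>\<^bsub>G\<^esub>"
    and "y \<in> carrier G \<Longrightarrow> e \<otimes>\<^bsub>G\<^esub> (x \<otimes>\<^bsub>G\<^esub> y) = x \<otimes>\<^bsub>G\<^esub> y"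
    and "y \<in> carrier G \<Longrightarrow> f \<otimes>\<^bsub>G\<^esub> (x \<otimes>\<^bsub>G\<^esub> y) = \<zero>\<^bsub>G\<^esub>"
proof -
  note D = blockD[OF x]
  have "f \<otimes>\<^bsub>G\<^esub> x = (f \<otimes>\<^bsub>G\<^esub> e) \<otimes>\<^bsub>G\<^esub> x" using D(1,2) by (simp only: m_assoc e_closed f_closed)
  then show *: "f \<otimes>\<^bsub>G\<^esub> x = \<zero>\<^bsub>G\<^esub>" using D by simp
  show "e \<otimes>\<^bsub>G\<^esub> x = x" by fact
  show "e \<otimes>\<^bsub>G\<^esub> (x \<otimes>\<^bsub>G\<^esub> y) = x \<otimes>\<^bsub>G\<^esub> y" if "y \<in> carrier G"
    using D that by (simp add: m_assoc[symmetric])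
  show "f \<otimes>\<^bsub>G\<^esub> (x \<otimes>\<^bsub>G\<^esub> y) = \<zero>\<^bsub>G\<^esub>" if "y \<in> carrier G"
    using D that * by (simp add: m_assoc[symmetric])
qed

lemma right_absorb:
  assumes x: "x \<in> peirce_block G p e"
  shows "x \<otimes>\<^bsub>G\<^esub> e = x" "x \<otimes>\<^bsub>G\<^esub> f = \<zero>\<^bsub>G\<^esub>"
    and "y \<in> carrier G \<Longrightarrow> x \<otimes>\<^bsub>G\<^esub> (e \<otimes>\<^bsub>G\<^esub> y) = x \<otimes>\<^bsub>G\<^esub> y"
    and "y \<in> carrier G \<Longrightarrow> x \<otimes>\<^bsub>G\<^esub> (f \<otimes>\<^bsub>G\<^esub> y) = \<zero>\<^bsub>G\<^esub>"
proof -
  note D = blockD[OF x]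
  have "x \<otimes>\<^bsub>G\<^esub> f = x \<otimes>\<^bsub>G\<^esub> (e \<otimes>\<^bsub>G\<^esub> f)" using D(1,3) m_assoc[OF D(1) e_closed f_closed] by simp
  then show *: "x \<otimes>\<^bsub>G\<^esub> f = \<zero>\<^bsub>G\<^esub>" using D by simp
  show "x \<otimes>\<^bsub>G\<^esub> e = x" by fact
  show "x \<otimes>\<^bsub>G\<^esub> (e \<otimes>\<^bsub>G\<^esub> y) = x \<otimes>\<^bsub>G\<^esub> y" if "y \<in> carrier G"
    using D that by (simp add: m_assoc[symmetric])
  show "x \<otimes>\<^bsub>G\<^esub> (f \<otimes>\<^bsub>G\<^esub> y) = \<zero>\<^bsub>G\<^esub>" if "y \<in> carrier G"
    using D that * by (simp add: m_assoc[symmetric])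
qed

text \<open>Multiplication by \<open>e\<close> or \<open>f\<close> on either side of a block element, also inside right-nested
  products; together with associativity these rules compute all products of blocks.\<close>

lemmas absorb = left_absorb right_absorb
  peirce_decomposition.left_absorb[OF peirce_swap] peirce_decomposition.right_absorb[OF peirce_swap]

lemma block_mult:
  assumes "x \<in> peirce_block G p q" "y \<in> peirce_block G q r"
    "p \<in> carrier G" "q \<in> carrier G" "r \<in> carrier G"
  shows "x \<otimes>\<^bsub>G\<^esub> y \<in> peirce_block G p r"
  using assms by (auto simp: peirce_block_def m_assoc) (simp add: m_assoc[symmetric])

lemma e_block: "e \<in> peirce_block G e e"
  by (simp add: peirce_block_def)

lemma decompose:
  assumes x: "x \<in> carrier G"
  obtains a m n b where "a \<in> peirce_block G e e" "m \<in> peirce_block G e f"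
    "n \<in> peirce_block G f e" "b \<in> peirce_block G f f"
    "x = a \<oplus>\<^bsub>G\<^esub> m \<oplus>\<^bsub>G\<^esub> n \<oplus>\<^bsub>G\<^esub> b"
proof
  have *: "p \<otimes>\<^bsub>G\<^esub> x \<otimes>\<^bsub>G\<^esub> q \<in> peirce_block G p q"
    if "p \<in> carrier G" "q \<in> carrier G" "p \<otimes>\<^bsub>G\<^esub> p = p" "q \<otimes>\<^bsub>G\<^esub> q = q" for p q
    using that x by (simp add: peirce_block_def m_assoc) (simp add: m_assoc[symmetric])
  show "e \<otimes>\<^bsub>G\<^esub> x \<otimes>\<^bsub>G\<^esub> e \<in> peirce_block G e e" "e \<otimes>\<^bsub>G\<^esub> x \<otimes>\<^bsub>G\<^esub> f \<in> peirce_block G e f"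
    "f \<otimes>\<^bsub>G\<^esub> x \<otimes>\<^bsub>G\<^esub> e \<in> peirce_block G f e" "f \<otimes>\<^bsub>G\<^esub> x \<otimes>\<^bsub>G\<^esub> f \<in> peirce_block G f f"
    by (simp_all add: *)
  have "x = (e \<oplus>\<^bsub>G\<^esub> f) \<otimes>\<^bsub>G\<^esub> x \<otimes>\<^bsub>G\<^esub> (e \<oplus>\<^bsub>G\<^esub> f)"
    using x by (simp add: e_plus_f)
  also have "\<dots> = e \<otimes>\<^bsub>G\<^esub> x \<otimes>\<^bsub>G\<^esub> e \<oplus>\<^bsub>G\<^esub> e \<otimes>\<^bsub>G\<^esub> x \<otimes>\<^bsub>G\<^esub> f \<oplus>\<^bsub>G\<^esub> f \<otimes>\<^bsub>G\<^esub> x \<otimes>\<^bsub>G\<^esub> e \<oplus>\<^bsub>G\<^esub> f \<otimes>\<^bsub>G\<^esub> x \<otimes>\<^bsub>G\<^esub> f"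
    using x by (simp add: l_distr r_distr M.a_ac)
  finally show "x = e \<otimes>\<^bsub>G\<^esub> x \<otimes>\<^bsub>G\<^esub> e \<oplus>\<^bsub>G\<^esub> e \<otimes>\<^bsub>G\<^esub> x \<otimes>\<^bsub>G\<^esub> f \<oplus>\<^bsub>G\<^esub> f \<otimes>\<^bsub>G\<^esub> x \<otimes>\<^bsub>G\<^esub> e \<oplus>\<^bsub>G\<^esub> f \<otimes>\<^bsub>G\<^esub> x \<otimes>\<^bsub>G\<^esub> f" .
qed

text \<open>A central $w = ew = we$ annihilates the off-diagonal blocks from the side on which they meet
  \<open>e\<close>: $wm = mw = mew = 0$ because $me = 0$, and dually for $nw$. Faithfulness concludes.\<close>

lemma central_block_zero:
  assumes w: "w \<in> center G" and b: "w \<in> peirce_block G e e"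
  shows "w = \<zero>\<^bsub>G\<^esub>"
proof (rule faithful_e[OF b]; intro ballI)
  fix m assume m: "m \<in> peirce_block G e f"
  have "w \<otimes>\<^bsub>G\<^esub> m = m \<otimes>\<^bsub>G\<^esub> (e \<otimes>\<^bsub>G\<^esub> w)"
    using center_commute[OF w blockD(1)[OF m]] b by (simp add: absorb)
  then show "w \<otimes>\<^bsub>G\<^esub> m = \<zero>\<^bsub>G\<^esub>"
    using m blockD(1)[OF b] by (simp add: absorb)
next
  fix n assume n: "n \<in> peirce_block G f e"
  have "n \<otimes>\<^bsub>G\<^esub> w = w \<otimes>\<^bsub>G\<^esub> e \<otimes>\<^bsub>G\<^esub> n"
    using center_commute[OF w blockD(1)[OF n]] b by (simp add: absorb)
  then show "n \<otimes>\<^bsub>G\<^esub> w = \<zero>\<^bsub>G\<^esub>"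
    using n blockD(1)[OF n] blockD(1)[OF b] by (simp add: absorb m_assoc)
qed

text \<open>With $w = [y,e]$ one has $ewe = 0 = fwf$ for any $y$. If $w$ is central, then $ewe = we$ and
  $fwf = wf$, so $w = we + wf = 0$.\<close>

lemma commutator_central_imp_commute:
  assumes y: "y \<in> carrier G" and c: "lie_bracket G y e \<in> center G"
  shows "y \<otimes>\<^bsub>G\<^esub> e = e \<otimes>\<^bsub>G\<^esub> y"
proof -
  let ?w = "lie_bracket G y e"
  have w: "?w \<in> carrier G" using y by (simp add: bracket_closed)
  have "e \<otimes>\<^bsub>G\<^esub> ?w \<otimes>\<^bsub>G\<^esub> e = \<zero>\<^bsub>G\<^esub>"
    using y by (simp add: lie_bracket_def minus_eq l_distr r_distr l_minus r_minus m_assoc)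
      (simp add: m_assoc[symmetric] r_neg)
  then have "?w \<otimes>\<^bsub>G\<^esub> e = \<zero>\<^bsub>G\<^esub>"
    using center_commute[OF c e_closed, symmetric] w by (simp add: m_assoc)
  moreover have "f \<otimes>\<^bsub>G\<^esub> ?w \<otimes>\<^bsub>G\<^esub> f = \<zero>\<^bsub>G\<^esub>"
    using y by (simp add: lie_bracket_def minus_eq l_distr r_distr l_minus r_minus m_assoc)
      (simp add: m_assoc[symmetric] r_neg)
  then have "?w \<otimes>\<^bsub>G\<^esub> f = \<zero>\<^bsub>G\<^esub>"
    using center_commute[OF c f_closed, symmetric] w by (simp add: m_assoc)
  ultimately have "?w \<otimes>\<^bsub>G\<^esub> (e \<oplus>\<^bsub>G\<^esub> f) = \<zero>\<^bsub>G\<^esub>"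
    using w by (simp add: r_distr)
  then have "?w = \<zero>\<^bsub>G\<^esub>" using w by (simp add: e_plus_f)
  then show ?thesis using y by (simp add: bracket_eq_zero_iff)
qed

text \<open>A central element commutes with \<open>e\<close>, whereas $ew = w$ and $we = 0$ on this block.\<close>

lemma central_off_diagonal_zero:
  assumes w: "w \<in> center G" and b: "w \<in> peirce_block G e f"
  shows "w = \<zero>\<^bsub>G\<^esub>"
  using center_commute[OF w e_closed] b by (simp add: absorb)

lemma diagonal_f:
  assumes y: "y \<in> carrier G" and c: "y \<otimes>\<^bsub>G\<^esub> e = e \<otimes>\<^bsub>G\<^esub> y"
  shows "y \<otimes>\<^bsub>G\<^esub> f = f \<otimes>\<^bsub>G\<^esub> y"
proof -
  have "y \<otimes>\<^bsub>G\<^esub> (e \<oplus>\<^bsub>G\<^esub> f) = (e \<oplus>\<^bsub>G\<^esub> f) \<otimes>\<^bsub>G\<^esub> y" using y by (simp add: e_plus_f)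
  then show ?thesis using y c by (simp add: l_distr r_distr)
qed

text \<open>Stability of the blocks under brackets with diagonal elements confines a central bracket to a
  single block, where it has to vanish.\<close>

lemma bracket_block:
  assumes y: "y \<in> carrier G" "y \<otimes>\<^bsub>G\<^esub> p = p \<otimes>\<^bsub>G\<^esub> y" "y \<otimes>\<^bsub>G\<^esub> q = q \<otimes>\<^bsub>G\<^esub> y"
    and p: "p \<in> carrier G" "q \<in> carrier G" and x: "x \<in> peirce_block G p q"
  shows "lie_bracket G y x \<in> peirce_block G p q"
proof -
  note D = blockD[OF x]
  have "p \<otimes>\<^bsub>G\<^esub> (y \<otimes>\<^bsub>G\<^esub> x) = y \<otimes>\<^bsub>G\<^esub> x" "x \<otimes>\<^bsub>G\<^esub> y \<otimes>\<^bsub>G\<^esub> q = x \<otimes>\<^bsub>G\<^esub> y"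
    using y p D by (metis m_assoc)+
  moreover have "p \<otimes>\<^bsub>G\<^esub> (x \<otimes>\<^bsub>G\<^esub> y) = x \<otimes>\<^bsub>G\<^esub> y" "y \<otimes>\<^bsub>G\<^esub> x \<otimes>\<^bsub>G\<^esub> q = y \<otimes>\<^bsub>G\<^esub> x"
    using y p D by (metis m_assoc)+
  ultimately show ?thesis
    using y p D by (simp add: peirce_block_def lie_bracket_def minus_eq l_distr r_distr l_minus r_minus)
qed

text \<open>Such a \<open>y\<close> is diagonal, so its bracket with an element of a block is a central element of that
  block, hence zero; the blocks span the algebra.\<close>

lemma commutators_central_imp_central:
  assumes y: "y \<in> carrier G" and c: "\<And>x. x \<in> carrier G \<Longrightarrow> lie_bracket G y x \<in> center G"
  shows "y \<in> center G"
proof -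
  interpret S: peirce_decomposition R G f e by (rule peirce_swap)
  have ye: "y \<otimes>\<^bsub>G\<^esub> e = e \<otimes>\<^bsub>G\<^esub> y" using commutator_central_imp_commute[OF y c] by simp
  note yf = diagonal_f[OF y ye]
  note B = bracket_block[OF y(1)]
  have "y \<otimes>\<^bsub>G\<^esub> x = x \<otimes>\<^bsub>G\<^esub> y" if x: "x \<in> carrier G" for x
  proof -
    obtain a m n b where d: "a \<in> peirce_block G e e" "m \<in> peirce_block G e f"
      "n \<in> peirce_block G f e" "b \<in> peirce_block G f f" "x = a \<oplus>\<^bsub>G\<^esub> m \<oplus>\<^bsub>G\<^esub> n \<oplus>\<^bsub>G\<^esub> b"
      using decompose[OF x] by blast
    note cl = d(1-4)[THEN blockD(1)]
    have "lie_bracket G y a = \<zero>\<^bsub>G\<^esub>" "lie_bracket G y m = \<zero>\<^bsub>G\<^esub>"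
      "lie_bracket G y n = \<zero>\<^bsub>G\<^esub>" "lie_bracket G y b = \<zero>\<^bsub>G\<^esub>"
      using c cl B ye yf d(1-4)
      by (simp_all add: central_block_zero central_off_diagonal_zero S.central_block_zero S.central_off_diagonal_zero)
    then show ?thesis
      using cl y by (simp add: d(5) bracket_eq_zero_iff l_distr r_distr)
  qed
  then show ?thesis using y by (simp add: center_iff)
qed

text \<open>This makes an off-diagonal bracket $[y,m]$ a triple bracket, to which a Lie triple centralizer
  applies.\<close>

lemma diagonal_bracket:
  assumes y: "y \<in> carrier G" "y \<otimes>\<^bsub>G\<^esub> e = e \<otimes>\<^bsub>G\<^esub> y" and m: "m \<in> peirce_block G e f"
  shows "lie_bracket G (lie_bracket G y m) f = lie_bracket G y m"
proof -
  have "lie_bracket G y m \<in> peirce_block G e f"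
    using y diagonal_f[OF y] m by (simp add: bracket_block)
  then show ?thesis
    unfolding lie_bracket_def[of G _ f] by (simp add: absorb blockD minus_eq)
qed

end

section \<open>Lie triple centralizers on a Peirce decomposition\<close>

locale lie_triple_peirce = peirce_decomposition +
  fixes \<phi> :: "'b \<Rightarrow> 'b"
  assumes ltc: "lie_triple_centralizer R G \<phi>"
begin

lemma lie_triple_swap: "lie_triple_peirce R G f e \<phi>"
  by (intro lie_triple_peirce.intro peirce_swap lie_triple_peirce_axioms.intro ltc)

lemma phi_closed [simp]: "x \<in> carrier G \<Longrightarrow> \<phi> x \<in> carrier G"
  and phi_add: "\<lbrakk>x \<in> carrier G; y \<in> carrier G\<rbrakk> \<Longrightarrow> \<phi> (x \<oplus>\<^bsub>G\<^esub> y) = \<phi> x \<oplus>\<^bsub>G\<^esub> \<phi> y"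
  and phi_smult: "\<lbrakk>r \<in> carrier R; x \<in> carrier G\<rbrakk> \<Longrightarrow> \<phi> (r \<odot>\<^bsub>G\<^esub> x) = r \<odot>\<^bsub>G\<^esub> \<phi> x"
  and phi_triple: "\<lbrakk>x \<in> carrier G; y \<in> carrier G; z \<in> carrier G\<rbrakk> \<Longrightarrow>
    \<phi> (lie_bracket G (lie_bracket G x y) z) = lie_bracket G (lie_bracket G (\<phi> x) y) z"
  using ltc by (auto simp: lie_triple_centralizer_def linear_map_def)

lemma phi_zero: "\<phi> \<zero>\<^bsub>G\<^esub> = \<zero>\<^bsub>G\<^esub>"
  using ltc linear_map_zero M.abelian_group_axioms by (auto simp: lie_triple_centralizer_def)

lemma phi_minus: "x \<in> carrier G \<Longrightarrow> \<phi> (\<ominus>\<^bsub>G\<^esub> x) = \<ominus>\<^bsub>G\<^esub> \<phi> x"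
  using ltc linear_map_minus M.abelian_group_axioms by (auto simp: lie_triple_centralizer_def)

lemma commute_imp_central_bracket:
  assumes x: "x \<in> carrier G" and y: "y \<in> carrier G" and c: "x \<otimes>\<^bsub>G\<^esub> y = y \<otimes>\<^bsub>G\<^esub> x"
  shows "lie_bracket G (\<phi> x) y \<in> center G"
proof -
  have "lie_bracket G (lie_bracket G (\<phi> x) y) z = \<zero>\<^bsub>G\<^esub>" if z: "z \<in> carrier G" for z
    using phi_triple[OF x y z] c x y z bracket_eq_zero_iff[of x y]
    by (simp add: phi_zero bracket_zero_left)
  then show ?thesis using x y by (simp add: center_iff_bracket bracket_closed)
qed

lemma phi_diagonal:
  assumes x: "x \<in> carrier G" and c: "x \<otimes>\<^bsub>G\<^esub> e = e \<otimes>\<^bsub>G\<^esub> x"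
  shows "\<phi> x \<otimes>\<^bsub>G\<^esub> e = e \<otimes>\<^bsub>G\<^esub> \<phi> x"
  using assms by (simp add: commutator_central_imp_commute commute_imp_central_bracket)

text \<open>All brackets $[\phi(1),x]$ are central, since $1$ commutes with every $x$.\<close>

lemma phi_one_central: "\<phi> \<one>\<^bsub>G\<^esub> \<in> center G"
  by (simp add: commutators_central_imp_central commute_imp_central_bracket)

text \<open>For $b \in fGf$ we have $ab = 0 = ba$, so $[\phi(a),b]$ is central; as $\phi(a)$ is diagonal, this
  bracket lies in $fGf$ and therefore vanishes.\<close>

lemma far_corner:
  assumes a: "a \<in> peirce_block G e e"
  shows "f \<otimes>\<^bsub>G\<^esub> \<phi> a \<in> peirce_block G f f"
    and "b \<in> peirce_block G f f \<Longrightarrow> (f \<otimes>\<^bsub>G\<^esub> \<phi> a) \<otimes>\<^bsub>G\<^esub> b = b \<otimes>\<^bsub>G\<^esub> (f \<otimes>\<^bsub>G\<^esub> \<phi> a)"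
proof -
  interpret S: lie_triple_peirce R G f e \<phi> by (rule lie_triple_swap)
  have [simp]: "a \<in> carrier G" using a by (rule blockD)
  have comm: "\<phi> a \<otimes>\<^bsub>G\<^esub> e = e \<otimes>\<^bsub>G\<^esub> \<phi> a" "\<phi> a \<otimes>\<^bsub>G\<^esub> f = f \<otimes>\<^bsub>G\<^esub> \<phi> a"
    using a by (simp_all add: phi_diagonal S.phi_diagonal absorb)
  show "f \<otimes>\<^bsub>G\<^esub> \<phi> a \<in> peirce_block G f f"
    using comm by (simp add: peirce_block_def m_assoc) (simp add: m_assoc[symmetric])
  assume b: "b \<in> peirce_block G f f"
  have [simp]: "b \<in> carrier G" using b by (rule blockD)
  have "a \<otimes>\<^bsub>G\<^esub> b = b \<otimes>\<^bsub>G\<^esub> a"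
    using right_absorb(4)[OF a, of b] S.right_absorb(4)[OF b, of a] blockD[OF a] blockD[OF b] by simp
  then have "lie_bracket G (\<phi> a) b = \<zero>\<^bsub>G\<^esub>"
    using b comm by (intro S.central_block_zero commute_imp_central_bracket bracket_block) simp_all
  then have "\<phi> a \<otimes>\<^bsub>G\<^esub> b = b \<otimes>\<^bsub>G\<^esub> \<phi> a" by (simp add: bracket_eq_zero_iff)
  then show "(f \<otimes>\<^bsub>G\<^esub> \<phi> a) \<otimes>\<^bsub>G\<^esub> b = b \<otimes>\<^bsub>G\<^esub> (f \<otimes>\<^bsub>G\<^esub> \<phi> a)"
    using b by (simp add: absorb m_assoc)
qed

text \<open>On a triple commutator of corner elements the value of $\phi$ is $[[\phi(x),y],z]$, which stays in
  $eGe$ because $\phi(x)$ is diagonal; so its far corner is zero. The corner is presented as the image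
  of an algebra \<open>A\<close> under \<open>j\<close>, so that spanning can be stated in \<open>A\<close> itself.\<close>

lemma far_corner_zero:
  assumes A: "unital_algebra R A" and span: "triple_commutators R A = carrier A"
    and lin: "linear_map R A G j" and block: "\<And>a. a \<in> carrier A \<Longrightarrow> j a \<in> peirce_block G e e"
    and mult: "\<And>a b. \<lbrakk>a \<in> carrier A; b \<in> carrier A\<rbrakk> \<Longrightarrow> j (a \<otimes>\<^bsub>A\<^esub> b) = j a \<otimes>\<^bsub>G\<^esub> j b"
    and a: "a \<in> carrier A"
  shows "f \<otimes>\<^bsub>G\<^esub> \<phi> (j a) = \<zero>\<^bsub>G\<^esub>"
proof -
  interpret A: unital_algebra R A by (rule A)
  note j_closed [simp] = linear_map_closed[OF lin]
  have j_bracket: "j (lie_bracket A x y) = lie_bracket G (j x) (j y)"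
    if "x \<in> carrier A" "y \<in> carrier A" for x y
    using that linear_map_minus[OF lin A.M.abelian_group_axioms M.abelian_group_axioms]
    by (simp add: lie_bracket_def A.minus_eq minus_eq linear_map_add[OF lin] mult)
  define K where "K = {a \<in> carrier A. f \<otimes>\<^bsub>G\<^esub> \<phi> (j a) = \<zero>\<^bsub>G\<^esub>}"
  have "submodule K R A"
    using linear_map_zero[OF lin A.M.abelian_group_axioms M.abelian_group_axioms]
      linear_map_minus[OF lin A.M.abelian_group_axioms M.abelian_group_axioms]
    by (intro A.submoduleI)
      (auto simp: K_def phi_zero phi_minus phi_add phi_smult r_minus r_distr smult_mult_right
        linear_map_add[OF lin] linear_map_smult[OF lin])
  moreover have "lie_bracket A (lie_bracket A x y) z \<in> K"
    if [simp]: "x \<in> carrier A" "y \<in> carrier A" "z \<in> carrier A" for x y z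
  proof -
    let ?w = "lie_bracket G (\<phi> (j x)) (j y)"
    have "\<phi> (j x) \<otimes>\<^bsub>G\<^esub> e = e \<otimes>\<^bsub>G\<^esub> \<phi> (j x)"
      using block[of x] by (simp add: phi_diagonal absorb)
    then have w: "?w \<in> peirce_block G e e"
      by (intro bracket_block block) simp_all
    have "f \<otimes>\<^bsub>G\<^esub> lie_bracket G ?w (j z) = \<zero>\<^bsub>G\<^esub>"
      unfolding lie_bracket_def[of G ?w] using w block[of z] blockD(1)[OF w]
      by (simp add: minus_eq r_distr r_minus absorb)
    then show ?thesis
      by (simp add: K_def A.bracket_closed j_bracket phi_triple)
  qed
  ultimately have "triple_commutators R A \<subseteq> K"
    unfolding triple_commutators_def by (intro Inter_lower) auto
  then show ?thesis using a by (auto simp: span K_def)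
qed

text \<open>From $am = [[a,m],f]$ follows $\phi(am) = [\phi(a),m]$, and in $m\phi(a) = mf\phi(a)$ only the far
  corner of $\phi(a)$ enters, which may be replaced by that of the central \<open>z\<close>.\<close>

lemma phi_upper:
  assumes a: "a \<in> peirce_block G e e" and m: "m \<in> peirce_block G e f"
    and z: "z \<in> center G" "f \<otimes>\<^bsub>G\<^esub> \<phi> a = f \<otimes>\<^bsub>G\<^esub> z"
  shows "\<phi> (a \<otimes>\<^bsub>G\<^esub> m) = (\<phi> a \<ominus>\<^bsub>G\<^esub> z) \<otimes>\<^bsub>G\<^esub> m"
proof -
  note [simp] = blockD(1)[OF a] blockD(1)[OF m] center_closed[OF z(1)]
  have comm: "a \<otimes>\<^bsub>G\<^esub> e = e \<otimes>\<^bsub>G\<^esub> a" using a by (simp add: absorb)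
  have "m \<otimes>\<^bsub>G\<^esub> a = m \<otimes>\<^bsub>G\<^esub> (e \<otimes>\<^bsub>G\<^esub> a)" using a by (simp add: left_absorb)
  then have "lie_bracket G a m = a \<otimes>\<^bsub>G\<^esub> m"
    using m by (simp add: lie_bracket_def minus_eq absorb)
  then have "\<phi> (a \<otimes>\<^bsub>G\<^esub> m) = \<phi> (lie_bracket G (lie_bracket G a m) f)"
    using diagonal_bracket[OF _ comm m] by simp
  also have "\<dots> = lie_bracket G (lie_bracket G (\<phi> a) m) f" by (rule phi_triple) simp_all
  also have "\<dots> = lie_bracket G (\<phi> a) m"
    using comm m by (simp add: diagonal_bracket phi_diagonal)
  also have "m \<otimes>\<^bsub>G\<^esub> \<phi> a = m \<otimes>\<^bsub>G\<^esub> (f \<otimes>\<^bsub>G\<^esub> \<phi> a)" using m by (simp add: absorb)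
  then have "m \<otimes>\<^bsub>G\<^esub> \<phi> a = z \<otimes>\<^bsub>G\<^esub> m"
    using m center_commute[OF z(1), of m] by (simp add: z(2) absorb)
  then have "lie_bracket G (\<phi> a) m = (\<phi> a \<ominus>\<^bsub>G\<^esub> z) \<otimes>\<^bsub>G\<^esub> m"
    by (simp add: lie_bracket_def minus_eq l_distr l_minus)
  finally show ?thesis .
qed

text \<open>The computation of \<open>phi_upper\<close> on the other off-diagonal block; here \<open>a\<close> acts from the right, so
  $-na = [[a,n],e]$.\<close>

lemma phi_lower:
  assumes a: "a \<in> peirce_block G e e" and n: "n \<in> peirce_block G f e"
    and z: "z \<in> center G" "f \<otimes>\<^bsub>G\<^esub> \<phi> a = f \<otimes>\<^bsub>G\<^esub> z"
  shows "\<phi> (n \<otimes>\<^bsub>G\<^esub> a) = n \<otimes>\<^bsub>G\<^esub> (\<phi> a \<ominus>\<^bsub>G\<^esub> z)"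
proof -
  interpret S: lie_triple_peirce R G f e \<phi> by (rule lie_triple_swap)
  note [simp] = blockD(1)[OF a] blockD(1)[OF n] center_closed[OF z(1)]
  have comm: "a \<otimes>\<^bsub>G\<^esub> f = f \<otimes>\<^bsub>G\<^esub> a" using a by (simp add: absorb)
  have "a \<otimes>\<^bsub>G\<^esub> n = a \<otimes>\<^bsub>G\<^esub> (f \<otimes>\<^bsub>G\<^esub> n)" using n by (simp add: S.left_absorb)
  then have "lie_bracket G a n = \<ominus>\<^bsub>G\<^esub> (n \<otimes>\<^bsub>G\<^esub> a)"
    using a by (simp add: lie_bracket_def minus_eq absorb)
  then have "\<ominus>\<^bsub>G\<^esub> \<phi> (n \<otimes>\<^bsub>G\<^esub> a) = \<phi> (lie_bracket G (lie_bracket G a n) e)"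
    using S.diagonal_bracket[OF _ comm n] by (simp add: phi_minus)
  also have "\<dots> = lie_bracket G (lie_bracket G (\<phi> a) n) e" by (rule phi_triple) simp_all
  also have "\<dots> = lie_bracket G (\<phi> a) n"
    using comm n by (simp add: S.diagonal_bracket S.phi_diagonal)
  also have "\<phi> a \<otimes>\<^bsub>G\<^esub> n = f \<otimes>\<^bsub>G\<^esub> \<phi> a \<otimes>\<^bsub>G\<^esub> n"
    using n comm by (simp add: S.phi_diagonal[symmetric] m_assoc absorb)
  then have "\<phi> a \<otimes>\<^bsub>G\<^esub> n = n \<otimes>\<^bsub>G\<^esub> z"
    using n center_commute[OF z(1), of n] by (simp add: z(2) absorb m_assoc)
  then have "lie_bracket G (\<phi> a) n = \<ominus>\<^bsub>G\<^esub> (n \<otimes>\<^bsub>G\<^esub> (\<phi> a \<ominus>\<^bsub>G\<^esub> z))"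
    by (simp add: lie_bracket_def minus_eq r_distr r_minus minus_add a_comm)
  finally show ?thesis by (metis add.inv_equality minus_minus m_closed phi_closed blockD(1)[OF a] blockD(1)[OF n] center_closed[OF z(1)] minus_closed)
qed

text \<open>The case $a = e$ of the two preceding formulas. Only the component of \<open>l\<close> in $eGe$ is prescribed:
  \<open>l\<close> being central, that component determines its action on both off-diagonal blocks.\<close>

lemma phi_off_diagonal:
  assumes z: "z \<in> center G" "f \<otimes>\<^bsub>G\<^esub> \<phi> e = f \<otimes>\<^bsub>G\<^esub> z"
    and l: "l \<in> center G" "e \<otimes>\<^bsub>G\<^esub> l = e \<otimes>\<^bsub>G\<^esub> (\<phi> e \<ominus>\<^bsub>G\<^esub> z)"
  shows "m \<in> peirce_block G e f \<Longrightarrow> \<phi> m = l \<otimes>\<^bsub>G\<^esub> m"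
    and "n \<in> peirce_block G f e \<Longrightarrow> \<phi> n = l \<otimes>\<^bsub>G\<^esub> n"
proof -
  note [simp] = center_closed[OF z(1)] center_closed[OF l(1)]
  have comm: "(\<phi> e \<ominus>\<^bsub>G\<^esub> z) \<otimes>\<^bsub>G\<^esub> e = e \<otimes>\<^bsub>G\<^esub> (\<phi> e \<ominus>\<^bsub>G\<^esub> z)"
    using phi_diagonal[of e] center_commute[OF z(1) e_closed]
    by (simp add: minus_eq l_distr r_distr l_minus r_minus)
  show "\<phi> m = l \<otimes>\<^bsub>G\<^esub> m" if m: "m \<in> peirce_block G e f"
  proof -
    note [simp] = blockD(1)[OF m]
    have "\<phi> m = (\<phi> e \<ominus>\<^bsub>G\<^esub> z) \<otimes>\<^bsub>G\<^esub> (e \<otimes>\<^bsub>G\<^esub> m)"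
      using phi_upper[OF e_block m z] m by (simp add: absorb)
    also have "\<dots> = (\<phi> e \<ominus>\<^bsub>G\<^esub> z) \<otimes>\<^bsub>G\<^esub> e \<otimes>\<^bsub>G\<^esub> m" by (simp add: m_assoc)
    also have "\<dots> = l \<otimes>\<^bsub>G\<^esub> e \<otimes>\<^bsub>G\<^esub> m"
      using center_commute[OF l(1) e_closed] by (simp add: comm l(2))
    finally show ?thesis using m by (simp add: m_assoc absorb)
  qed
  show "\<phi> n = l \<otimes>\<^bsub>G\<^esub> n" if n: "n \<in> peirce_block G f e"
  proof -
    note [simp] = blockD(1)[OF n]
    have "\<phi> n = n \<otimes>\<^bsub>G\<^esub> (\<phi> e \<ominus>\<^bsub>G\<^esub> z)"
      using phi_lower[OF e_block n z] n by (simp add: absorb)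
    also have "\<dots> = n \<otimes>\<^bsub>G\<^esub> (e \<otimes>\<^bsub>G\<^esub> (\<phi> e \<ominus>\<^bsub>G\<^esub> z))" using n by (simp add: absorb)
    also have "\<dots> = l \<otimes>\<^bsub>G\<^esub> n"
      using n center_commute[OF l(1), of n] by (simp add: l(2)[symmetric] absorb)
    finally show ?thesis .
  qed
qed

text \<open>The difference $y = \phi(a) - z - la$ has no component in $fGf$ by the choice of \<open>z\<close>. Comparing
  $\phi(av) = l(av)$ with $\phi(av) = (\phi(a) - z)v$ gives $yv = 0$, and likewise on the other side, so
  the component of \<open>y\<close> in $eGe$ vanishes by faithfulness.\<close>

lemma phi_corner:
  assumes z: "z \<in> center G" "f \<otimes>\<^bsub>G\<^esub> \<phi> a = f \<otimes>\<^bsub>G\<^esub> z" and a: "a \<in> peirce_block G e e"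
    and l: "l \<in> center G"
    and m: "\<And>m. m \<in> peirce_block G e f \<Longrightarrow> \<phi> m = l \<otimes>\<^bsub>G\<^esub> m"
    and n: "\<And>n. n \<in> peirce_block G f e \<Longrightarrow> \<phi> n = l \<otimes>\<^bsub>G\<^esub> n"
  shows "\<phi> a = l \<otimes>\<^bsub>G\<^esub> a \<oplus>\<^bsub>G\<^esub> z"
proof -
  note [simp] = center_closed[OF z(1)] center_closed[OF l(1)] blockD(1)[OF a]
  define y where "y = \<phi> a \<ominus>\<^bsub>G\<^esub> z \<ominus>\<^bsub>G\<^esub> l \<otimes>\<^bsub>G\<^esub> a"
  have y [simp]: "y \<in> carrier G" by (simp add: y_def)
  have la: "l \<otimes>\<^bsub>G\<^esub> a \<otimes>\<^bsub>G\<^esub> e = e \<otimes>\<^bsub>G\<^esub> (l \<otimes>\<^bsub>G\<^esub> a)"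
    using a center_commute[OF l e_closed] center_commute[OF l, of a]
    by (simp add: m_assoc absorb)
  have ye: "y \<otimes>\<^bsub>G\<^esub> e = e \<otimes>\<^bsub>G\<^esub> y"
    using phi_diagonal[of a] a la center_commute[OF z(1) e_closed]
    by (simp add: y_def minus_eq l_distr r_distr l_minus r_minus absorb)
  have ey: "e \<otimes>\<^bsub>G\<^esub> y \<in> peirce_block G e e"
    by (simp add: peirce_block_def m_assoc ye) (simp add: m_assoc[symmetric])
  have "e \<otimes>\<^bsub>G\<^esub> y = \<zero>\<^bsub>G\<^esub>"
  proof (rule faithful_e[OF ey]; intro ballI)
    fix v assume v: "v \<in> peirce_block G e f"
    note [simp] = blockD(1)[OF v]
    have "(\<phi> a \<ominus>\<^bsub>G\<^esub> z) \<otimes>\<^bsub>G\<^esub> v = l \<otimes>\<^bsub>G\<^esub> (a \<otimes>\<^bsub>G\<^esub> v)"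
      using phi_upper[OF a v z] m[OF block_mult[OF a v]] by simp
    then have "y \<otimes>\<^bsub>G\<^esub> v = \<zero>\<^bsub>G\<^esub>"
      by (simp add: y_def minus_eq[of _ "l \<otimes>\<^bsub>G\<^esub> a"] l_distr l_minus m_assoc r_neg)
    then show "e \<otimes>\<^bsub>G\<^esub> y \<otimes>\<^bsub>G\<^esub> v = \<zero>\<^bsub>G\<^esub>" by (simp add: m_assoc)
  next
    fix v assume v: "v \<in> peirce_block G f e"
    note [simp] = blockD(1)[OF v]
    have "v \<otimes>\<^bsub>G\<^esub> (\<phi> a \<ominus>\<^bsub>G\<^esub> z) = l \<otimes>\<^bsub>G\<^esub> (v \<otimes>\<^bsub>G\<^esub> a)"
      using phi_lower[OF a v z] n[OF block_mult[OF v a]] by simp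
    also have "\<dots> = v \<otimes>\<^bsub>G\<^esub> (l \<otimes>\<^bsub>G\<^esub> a)"
      using center_commute[OF l, of v] by (simp add: m_assoc[symmetric])
    finally have "v \<otimes>\<^bsub>G\<^esub> y = \<zero>\<^bsub>G\<^esub>"
      by (simp add: y_def minus_eq[of _ "l \<otimes>\<^bsub>G\<^esub> a"] r_distr r_minus r_neg)
    then show "v \<otimes>\<^bsub>G\<^esub> (e \<otimes>\<^bsub>G\<^esub> y) = \<zero>\<^bsub>G\<^esub>" using v by (simp add: absorb)
  qed
  moreover have "f \<otimes>\<^bsub>G\<^esub> (l \<otimes>\<^bsub>G\<^esub> a) = \<zero>\<^bsub>G\<^esub>"
    using a center_commute[OF l f_closed] center_commute[OF l, of a] by (simp add: absorb)
  then have "f \<otimes>\<^bsub>G\<^esub> y = \<zero>\<^bsub>G\<^esub>"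
    by (simp add: y_def minus_eq r_distr r_minus z(2) r_neg)
  ultimately have "(e \<oplus>\<^bsub>G\<^esub> f) \<otimes>\<^bsub>G\<^esub> y = \<zero>\<^bsub>G\<^esub>" by (simp add: l_distr)
  then have "y = \<zero>\<^bsub>G\<^esub>" by (simp add: e_plus_f)
  then have "\<phi> a \<ominus>\<^bsub>G\<^esub> z = l \<otimes>\<^bsub>G\<^esub> a" by (simp add: y_def diff_zero_iff)
  then have "\<phi> a \<ominus>\<^bsub>G\<^esub> z \<oplus>\<^bsub>G\<^esub> z = l \<otimes>\<^bsub>G\<^esub> a \<oplus>\<^bsub>G\<^esub> z" by simp
  then show ?thesis by (simp add: minus_eq a_assoc l_neg)
qed

text \<open>With $\lambda = \phi(1) - z_e - z_f$, the map $\chi = \phi - \lambda$ is zero on the off-diagonal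
  blocks and central on the diagonal ones. It kills triple commutators because
  $\phi([[a,b],c]) = [[\lambda a + \chi(a),b],c] = \lambda[[a,b],c]$.\<close>

lemma far_corners_central_imp_proper:
  assumes corner_e: "\<And>a. a \<in> peirce_block G e e \<Longrightarrow> \<exists>z\<in>center G. f \<otimes>\<^bsub>G\<^esub> \<phi> a = f \<otimes>\<^bsub>G\<^esub> z"
    and corner_f: "\<And>b. b \<in> peirce_block G f f \<Longrightarrow> \<exists>z\<in>center G. e \<otimes>\<^bsub>G\<^esub> \<phi> b = e \<otimes>\<^bsub>G\<^esub> z"
  shows "proper_lie_triple_centralizer R G \<phi>"
proof -
  interpret S: lie_triple_peirce R G f e \<phi> by (rule lie_triple_swap)
  obtain z1 z2 where z1: "z1 \<in> center G" "f \<otimes>\<^bsub>G\<^esub> \<phi> e = f \<otimes>\<^bsub>G\<^esub> z1"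
    and z2: "z2 \<in> center G" "e \<otimes>\<^bsub>G\<^esub> \<phi> f = e \<otimes>\<^bsub>G\<^esub> z2"
    using corner_e[OF e_block] corner_f[OF S.e_block] by blast
  note [simp] = center_closed[OF z1(1)] center_closed[OF z2(1)]
  define l where "l = \<phi> \<one>\<^bsub>G\<^esub> \<ominus>\<^bsub>G\<^esub> z1 \<ominus>\<^bsub>G\<^esub> z2"
  have l: "l \<in> center G"
    unfolding l_def by (intro diff_center phi_one_central z1 z2)
  note [simp] = center_closed[OF l]
  have "\<phi> \<one>\<^bsub>G\<^esub> = \<phi> e \<oplus>\<^bsub>G\<^esub> \<phi> f" by (simp add: e_plus_f[symmetric] phi_add)
  then have "l = (\<phi> e \<ominus>\<^bsub>G\<^esub> z1) \<oplus>\<^bsub>G\<^esub> (\<phi> f \<ominus>\<^bsub>G\<^esub> z2)"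
    by (simp add: l_def minus_eq M.a_ac)
  \<comment> \<open>In the block of \<open>e\<close> the second summand disappears, by the choice of \<open>z2\<close>.\<close>
  then have el: "e \<otimes>\<^bsub>G\<^esub> l = e \<otimes>\<^bsub>G\<^esub> (\<phi> e \<ominus>\<^bsub>G\<^esub> z1)"
    by (simp add: r_distr[of _ _ e] minus_eq[of "\<phi> f"] r_minus z2(2) r_neg)
  note upper = phi_off_diagonal(1)[OF z1 l el] and lower = phi_off_diagonal(2)[OF z1 l el]
  define \<chi> where "\<chi> x = \<phi> x \<ominus>\<^bsub>G\<^esub> l \<otimes>\<^bsub>G\<^esub> x" for x
  have split_diff: "u = v \<oplus>\<^bsub>G\<^esub> (u \<ominus>\<^bsub>G\<^esub> v)" if "u \<in> carrier G" "v \<in> carrier G" for u v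
    using that by algebra
  have phi_eq: "\<phi> x = l \<otimes>\<^bsub>G\<^esub> x \<oplus>\<^bsub>G\<^esub> \<chi> x" if "x \<in> carrier G" for x
    unfolding \<chi>_def using that by (intro split_diff) simp_all
  have chi_add: "\<chi> (x \<oplus>\<^bsub>G\<^esub> y) = \<chi> x \<oplus>\<^bsub>G\<^esub> \<chi> y" if "x \<in> carrier G" "y \<in> carrier G" for x y
    using that by (simp add: \<chi>_def minus_eq r_distr phi_add minus_add M.a_ac)
  have chi_central: "\<chi> x \<in> center G" if x: "x \<in> carrier G" for x
  proof -
    obtain a m n b where d: "a \<in> peirce_block G e e" "m \<in> peirce_block G e f"
      "n \<in> peirce_block G f e" "b \<in> peirce_block G f f" "x = a \<oplus>\<^bsub>G\<^esub> m \<oplus>\<^bsub>G\<^esub> n \<oplus>\<^bsub>G\<^esub> b"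
      using decompose[OF x] by blast
    note [simp] = d(1-4)[THEN blockD(1)]
    obtain z where z: "z \<in> center G" "f \<otimes>\<^bsub>G\<^esub> \<phi> a = f \<otimes>\<^bsub>G\<^esub> z" using corner_e d by blast
    obtain w where w: "w \<in> center G" "e \<otimes>\<^bsub>G\<^esub> \<phi> b = e \<otimes>\<^bsub>G\<^esub> w" using corner_f d by blast
    note [simp] = center_closed[OF z(1)] center_closed[OF w(1)]
    have cancel: "u \<oplus>\<^bsub>G\<^esub> v \<ominus>\<^bsub>G\<^esub> u = v" if "u \<in> carrier G" "v \<in> carrier G" for u v
      using that by algebra
    have "\<chi> a = z" "\<chi> b = w"
      using phi_corner[OF z d(1) l upper lower] S.phi_corner[OF w d(4) l lower upper]
      by (simp_all add: \<chi>_def cancel)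
    moreover have "\<chi> m = \<zero>\<^bsub>G\<^esub>" "\<chi> n = \<zero>\<^bsub>G\<^esub>"
      using d(2,3) by (simp_all add: \<chi>_def upper lower diff_zero_iff)
    ultimately show ?thesis
      using z w by (simp add: d(5) chi_add add_center)
  qed
  have lin: "linear_map R G G \<phi>" using ltc by (simp add: lie_triple_centralizer_def)
  show ?thesis
    unfolding proper_lie_triple_centralizer_def
  proof (intro conjI lin bexI[OF _ l] exI[of _ \<chi>] ballI funcsetI phi_eq chi_central)
    show "linear_map R G G \<chi>"
      unfolding linear_map_def
      by (auto simp: chi_add chi_central center_closed)
        (simp add: \<chi>_def phi_smult minus_eq smult_r_distr smult_r_minus smult_mult_right)
    show "\<chi> (lie_bracket G (lie_bracket G a b) c) = \<zero>\<^bsub>G\<^esub>"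
      if "a \<in> carrier G" "b \<in> carrier G" "c \<in> carrier G" for a b c
    proof -
      note [simp] = that center_closed[OF chi_central] bracket_closed
      have "\<phi> (lie_bracket G (lie_bracket G a b) c)
          = lie_bracket G (lie_bracket G (l \<otimes>\<^bsub>G\<^esub> a \<oplus>\<^bsub>G\<^esub> \<chi> a) b) c"
        by (simp add: phi_triple phi_eq[of a])
      also have "\<dots> = l \<otimes>\<^bsub>G\<^esub> lie_bracket G (lie_bracket G a b) c"
        using chi_central[of a]
        by (simp add: bracket_add_left bracket_central_left l center_iff_bracket bracket_zero_left)
      finally show ?thesis by (simp add: \<chi>_def diff_zero_iff)
    qed
  qed
qed

end

text \<open>The converse holds in every algebra: the central part $\chi(a)$ drops out of the brackets.\<close>

lemma (in unital_algebra) proper_imp_lie_triple_centralizer: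
  assumes "proper_lie_triple_centralizer R G \<phi>"
  shows "lie_triple_centralizer R G \<phi>"
proof -
  obtain l \<chi> where lin: "linear_map R G G \<phi>" and l: "l \<in> center G"
    and chi: "\<chi> \<in> carrier G \<rightarrow> center G"
      "\<And>a b c. \<lbrakk>a \<in> carrier G; b \<in> carrier G; c \<in> carrier G\<rbrakk> \<Longrightarrow>
        \<chi> (lie_bracket G (lie_bracket G a b) c) = \<zero>\<^bsub>G\<^esub>"
    and eq: "\<And>a. a \<in> carrier G \<Longrightarrow> \<phi> a = l \<otimes>\<^bsub>G\<^esub> a \<oplus>\<^bsub>G\<^esub> \<chi> a"
    using assms unfolding proper_lie_triple_centralizer_def by blast
  show ?thesis
    unfolding lie_triple_centralizer_def
  proof (intro conjI lin ballI)
    fix a b c assume [simp]: "a \<in> carrier G" "b \<in> carrier G" "c \<in> carrier G"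
    have central: "\<chi> a \<in> center G" using chi(1) by auto
    note [simp] = center_closed[OF l] center_closed[OF central] bracket_closed
    show "\<phi> (lie_bracket G (lie_bracket G a b) c) = lie_bracket G (lie_bracket G (\<phi> a) b) c"
      using central
      by (simp add: eq chi(2) bracket_add_left bracket_central_left l center_iff_bracket bracket_zero_left)
  qed
qed

section \<open>Generalized matrix algebras\<close>

context unital_bimodule
begin

lemma act_zero:
  shows "a \<in> carrier A \<Longrightarrow> lact M a \<zero>\<^bsub>M\<^esub> = \<zero>\<^bsub>M\<^esub>" "m \<in> carrier M \<Longrightarrow> lact M \<zero>\<^bsub>A\<^esub> m = \<zero>\<^bsub>M\<^esub>"
    and "b \<in> carrier B \<Longrightarrow> ract M \<zero>\<^bsub>M\<^esub> b = \<zero>\<^bsub>M\<^esub>" "m \<in> carrier M \<Longrightarrow> ract M m \<zero>\<^bsub>B\<^esub> = \<zero>\<^bsub>M\<^esub>"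
proof -
  have "linear_map R M M (lact M a)" if "a \<in> carrier A"
    using that by (auto simp: linear_map_def lact_closed lact_add_right lact_smult_right)
  then show "a \<in> carrier A \<Longrightarrow> lact M a \<zero>\<^bsub>M\<^esub> = \<zero>\<^bsub>M\<^esub>"
    using linear_map_zero M.abelian_group_axioms by blast
  have "linear_map R A M (\<lambda>a. lact M a m)" if "m \<in> carrier M"
    using that by (auto simp: linear_map_def lact_closed lact_add_left lact_smult_left)
  then show "m \<in> carrier M \<Longrightarrow> lact M \<zero>\<^bsub>A\<^esub> m = \<zero>\<^bsub>M\<^esub>"
    using linear_map_zero[where h = "\<lambda>a. lact M a m"] M.abelian_group_axioms A.M.abelian_group_axioms by blast
  have "linear_map R M M (\<lambda>m. ract M m b)" if "b \<in> carrier B"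
    using that by (auto simp: linear_map_def ract_closed ract_add_left ract_smult_left)
  then show "b \<in> carrier B \<Longrightarrow> ract M \<zero>\<^bsub>M\<^esub> b = \<zero>\<^bsub>M\<^esub>"
    using linear_map_zero[where h = "\<lambda>m. ract M m b"] M.abelian_group_axioms by blast
  have "linear_map R B M (ract M m)" if "m \<in> carrier M"
    using that by (auto simp: linear_map_def ract_closed ract_add_right ract_smult_right)
  then show "m \<in> carrier M \<Longrightarrow> ract M m \<zero>\<^bsub>B\<^esub> = \<zero>\<^bsub>M\<^esub>"
    using linear_map_zero M.abelian_group_axioms B.M.abelian_group_axioms by blast
qed

end

context unital_morita_context
begin

abbreviation U where "U \<equiv> gen_matrix_algebra A B M N mn nm"

lemma mn_linear: "m \<in> carrier M \<Longrightarrow> linear_map R N A (mn m)"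
    "n \<in> carrier N \<Longrightarrow> linear_map R M A (\<lambda>m. mn m n)"
  and mn_balanced: "\<lbrakk>m \<in> carrier M; b \<in> carrier B; n \<in> carrier N\<rbrakk> \<Longrightarrow>
      mn (ract M m b) n = mn m (lact N b n)"
  and mn_lact: "\<lbrakk>a \<in> carrier A; m \<in> carrier M; n \<in> carrier N\<rbrakk> \<Longrightarrow>
      mn (lact M a m) n = a \<otimes>\<^bsub>A\<^esub> mn m n"
  and mn_ract: "\<lbrakk>a \<in> carrier A; m \<in> carrier M; n \<in> carrier N\<rbrakk> \<Longrightarrow>
      mn m (ract N n a) = mn m n \<otimes>\<^bsub>A\<^esub> a"
  using mn_pairing by (simp_all add: balanced_pairing_def)

lemma nm_linear: "n \<in> carrier N \<Longrightarrow> linear_map R M B (nm n)"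
    "m \<in> carrier M \<Longrightarrow> linear_map R N B (\<lambda>n. nm n m)"
  and nm_balanced: "\<lbrakk>n \<in> carrier N; a \<in> carrier A; m \<in> carrier M\<rbrakk> \<Longrightarrow>
      nm (ract N n a) m = nm n (lact M a m)"
  and nm_lact: "\<lbrakk>b \<in> carrier B; n \<in> carrier N; m \<in> carrier M\<rbrakk> \<Longrightarrow>
      nm (lact N b n) m = b \<otimes>\<^bsub>B\<^esub> nm n m"
  and nm_ract: "\<lbrakk>b \<in> carrier B; n \<in> carrier N; m \<in> carrier M\<rbrakk> \<Longrightarrow>
      nm n (ract M m b) = nm n m \<otimes>\<^bsub>B\<^esub> b"
  using nm_pairing by (simp_all add: balanced_pairing_def)

lemma pairing_simps:
  shows "\<lbrakk>m \<in> carrier M; n \<in> carrier N\<rbrakk> \<Longrightarrow> mn m n \<in> carrier A"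
    and "\<lbrakk>m \<in> carrier M; n \<in> carrier N\<rbrakk> \<Longrightarrow> nm n m \<in> carrier B"
    and "\<lbrakk>m \<in> carrier M; n \<in> carrier N; n' \<in> carrier N\<rbrakk> \<Longrightarrow> mn m (n \<oplus>\<^bsub>N\<^esub> n') = mn m n \<oplus>\<^bsub>A\<^esub> mn m n'"
    and "\<lbrakk>m \<in> carrier M; m' \<in> carrier M; n \<in> carrier N\<rbrakk> \<Longrightarrow> mn (m \<oplus>\<^bsub>M\<^esub> m') n = mn m n \<oplus>\<^bsub>A\<^esub> mn m' n"
    and "\<lbrakk>m \<in> carrier M; m' \<in> carrier M; n \<in> carrier N\<rbrakk> \<Longrightarrow> nm n (m \<oplus>\<^bsub>M\<^esub> m') = nm n m \<oplus>\<^bsub>B\<^esub> nm n m'"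
    and "\<lbrakk>m \<in> carrier M; n \<in> carrier N; n' \<in> carrier N\<rbrakk> \<Longrightarrow> nm (n \<oplus>\<^bsub>N\<^esub> n') m = nm n m \<oplus>\<^bsub>B\<^esub> nm n' m"
    and "\<lbrakk>r \<in> carrier R; m \<in> carrier M; n \<in> carrier N\<rbrakk> \<Longrightarrow> mn m (r \<odot>\<^bsub>N\<^esub> n) = r \<odot>\<^bsub>A\<^esub> mn m n"
    and "\<lbrakk>r \<in> carrier R; m \<in> carrier M; n \<in> carrier N\<rbrakk> \<Longrightarrow> mn (r \<odot>\<^bsub>M\<^esub> m) n = r \<odot>\<^bsub>A\<^esub> mn m n"
    and "\<lbrakk>r \<in> carrier R; m \<in> carrier M; n \<in> carrier N\<rbrakk> \<Longrightarrow> nm n (r \<odot>\<^bsub>M\<^esub> m) = r \<odot>\<^bsub>B\<^esub> nm n m"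
    and "\<lbrakk>r \<in> carrier R; m \<in> carrier M; n \<in> carrier N\<rbrakk> \<Longrightarrow> nm (r \<odot>\<^bsub>N\<^esub> n) m = r \<odot>\<^bsub>B\<^esub> nm n m"
  using mn_linear nm_linear by (auto simp: linear_map_def Pi_iff)

lemma pairing_zero:
  shows "m \<in> carrier M \<Longrightarrow> mn m \<zero>\<^bsub>N\<^esub> = \<zero>\<^bsub>A\<^esub>" "n \<in> carrier N \<Longrightarrow> mn \<zero>\<^bsub>M\<^esub> n = \<zero>\<^bsub>A\<^esub>"
    and "n \<in> carrier N \<Longrightarrow> nm n \<zero>\<^bsub>M\<^esub> = \<zero>\<^bsub>B\<^esub>" "m \<in> carrier M \<Longrightarrow> nm \<zero>\<^bsub>N\<^esub> m = \<zero>\<^bsub>B\<^esub>"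
  using linear_map_zero[OF mn_linear(1)] linear_map_zero[OF mn_linear(2)]
    linear_map_zero[OF nm_linear(1)] linear_map_zero[OF nm_linear(2)]
    M.A.M.abelian_group_axioms M.B.M.abelian_group_axioms
    M.M.M.abelian_group_axioms N.M.M.abelian_group_axioms by auto

lemmas module_simps =
  M.lact_closed M.ract_closed M.lact_add_left M.lact_add_right M.ract_add_left M.ract_add_right
  M.lact_smult_left M.lact_smult_right M.ract_smult_left M.ract_smult_right
  M.lact_mult M.ract_mult M.lact_ract M.lact_one M.ract_one
  N.lact_closed N.ract_closed N.lact_add_left N.lact_add_right N.ract_add_left N.ract_add_right
  N.lact_smult_left N.lact_smult_right N.ract_smult_left N.ract_smult_right
  N.lact_mult N.ract_mult N.lact_ract N.lact_one N.ract_one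

lemmas morita_simps [simp] = pairing_simps pairing_zero module_simps M.act_zero N.act_zero
  mn_balanced mn_lact mn_ract nm_balanced nm_lact nm_ract mn_m nm_n

lemma in_U [simp]: "GMat a m n b \<in> carrier U \<longleftrightarrow>
    a \<in> carrier A \<and> m \<in> carrier M \<and> n \<in> carrier N \<and> b \<in> carrier B"
  by (simp add: gen_matrix_algebra_def)

lemma U_simps [simp]:
  shows "GMat a m n b \<otimes>\<^bsub>U\<^esub> GMat a' m' n' b' = GMat
      (a \<otimes>\<^bsub>A\<^esub> a' \<oplus>\<^bsub>A\<^esub> mn m n') (lact M a m' \<oplus>\<^bsub>M\<^esub> ract M m b')
      (ract N n a' \<oplus>\<^bsub>N\<^esub> lact N b n') (nm n m' \<oplus>\<^bsub>B\<^esub> b \<otimes>\<^bsub>B\<^esub> b')"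
    and "GMat a m n b \<oplus>\<^bsub>U\<^esub> GMat a' m' n' b' =
      GMat (a \<oplus>\<^bsub>A\<^esub> a') (m \<oplus>\<^bsub>M\<^esub> m') (n \<oplus>\<^bsub>N\<^esub> n') (b \<oplus>\<^bsub>B\<^esub> b')"
    and "r \<odot>\<^bsub>U\<^esub> GMat a m n b = GMat (r \<odot>\<^bsub>A\<^esub> a) (r \<odot>\<^bsub>M\<^esub> m) (r \<odot>\<^bsub>N\<^esub> n) (r \<odot>\<^bsub>B\<^esub> b)"
    and "\<one>\<^bsub>U\<^esub> = GMat \<one>\<^bsub>A\<^esub> \<zero>\<^bsub>M\<^esub> \<zero>\<^bsub>N\<^esub> \<one>\<^bsub>B\<^esub>" "\<zero>\<^bsub>U\<^esub> = GMat \<zero>\<^bsub>A\<^esub> \<zero>\<^bsub>M\<^esub> \<zero>\<^bsub>N\<^esub> \<zero>\<^bsub>B\<^esub>"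
  by (simp_all add: gen_matrix_algebra_def)

lemma U_cases:
  assumes "x \<in> carrier U"
  obtains a m n b where "x = GMat a m n b" "a \<in> carrier A" "m \<in> carrier M" "n \<in> carrier N" "b \<in> carrier B"
  using assms by (cases x) auto

lemmas entry_add_ac = M.A.M.a_ac M.B.M.a_ac M.M.M.a_ac N.M.M.a_ac

lemma U_abelian_group: "abelian_group U"
proof (rule abelian_groupI)
  fix x assume "x \<in> carrier U"
  then show "\<exists>y\<in>carrier U. y \<oplus>\<^bsub>U\<^esub> x = \<zero>\<^bsub>U\<^esub>"
    by (elim U_cases, intro bexI[of _ "GMat (\<ominus>\<^bsub>A\<^esub> piA x) (\<ominus>\<^bsub>M\<^esub> entryM x) (\<ominus>\<^bsub>N\<^esub> entryN x) (\<ominus>\<^bsub>B\<^esub> piB x)"])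
      (simp_all add: M.A.l_neg M.B.l_neg M.M.l_neg N.M.l_neg)
qed (auto elim!: U_cases simp: entry_add_ac)

lemma U_monoid: "monoid U"
  by (rule monoidI) (auto elim!: U_cases simp: entry_add_ac M.A.m_assoc M.B.m_assoc
    M.A.l_distr M.A.r_distr M.B.l_distr M.B.r_distr)

lemma U_ring: "ring U"
  by (rule ringI[OF U_abelian_group U_monoid]) (auto elim!: U_cases simp: entry_add_ac
    M.A.l_distr M.A.r_distr M.B.l_distr M.B.r_distr)

lemma U_module: "module R U"
  by (rule moduleI[OF M.A.R.is_cring U_abelian_group]) (auto elim!: U_cases
    simp: M.A.smult_l_distr M.B.smult_l_distr M.M.smult_l_distr N.M.smult_l_distr
    M.A.smult_r_distr M.B.smult_r_distr M.M.smult_r_distr N.M.smult_r_distr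
    M.A.smult_assoc1 M.B.smult_assoc1 M.M.smult_assoc1 N.M.smult_assoc1)

lemma U_unital_algebra: "unital_algebra R U"
  by (intro unital_algebra.intro U_module U_ring unital_algebra_axioms.intro)
    (auto elim!: U_cases simp: M.A.smult_mult_left M.B.smult_mult_left M.A.smult_mult_right M.B.smult_mult_right
    M.A.smult_r_distr M.B.smult_r_distr M.M.smult_r_distr N.M.smult_r_distr)

section \<open>The diagonal idempotents of a generalized matrix algebra\<close>

abbreviation E where "E \<equiv> GMat \<one>\<^bsub>A\<^esub> \<zero>\<^bsub>M\<^esub> \<zero>\<^bsub>N\<^esub> \<zero>\<^bsub>B\<^esub>"
abbreviation F where "F \<equiv> GMat \<zero>\<^bsub>A\<^esub> \<zero>\<^bsub>M\<^esub> \<zero>\<^bsub>N\<^esub> \<one>\<^bsub>B\<^esub>"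

lemma blocks:
  shows "peirce_block U E E = {GMat a \<zero>\<^bsub>M\<^esub> \<zero>\<^bsub>N\<^esub> \<zero>\<^bsub>B\<^esub> | a. a \<in> carrier A}"
    and "peirce_block U E F = {GMat \<zero>\<^bsub>A\<^esub> m \<zero>\<^bsub>N\<^esub> \<zero>\<^bsub>B\<^esub> | m. m \<in> carrier M}"
    and "peirce_block U F E = {GMat \<zero>\<^bsub>A\<^esub> \<zero>\<^bsub>M\<^esub> n \<zero>\<^bsub>B\<^esub> | n. n \<in> carrier N}"
    and "peirce_block U F F = {GMat \<zero>\<^bsub>A\<^esub> \<zero>\<^bsub>M\<^esub> \<zero>\<^bsub>N\<^esub> b | b. b \<in> carrier B}"
  by (auto simp: peirce_block_def elim!: U_cases)

lemma U_peirce: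
  assumes faithful_A: "\<And>a. \<lbrakk>a \<in> carrier A; \<forall>m\<in>carrier M. lact M a m = \<zero>\<^bsub>M\<^esub>;
        \<forall>n\<in>carrier N. ract N n a = \<zero>\<^bsub>N\<^esub>\<rbrakk> \<Longrightarrow> a = \<zero>\<^bsub>A\<^esub>"
    and faithful_B: "\<And>b. \<lbrakk>b \<in> carrier B; \<forall>m\<in>carrier M. ract M m b = \<zero>\<^bsub>M\<^esub>;
        \<forall>n\<in>carrier N. lact N b n = \<zero>\<^bsub>N\<^esub>\<rbrakk> \<Longrightarrow> b = \<zero>\<^bsub>B\<^esub>"
  shows "peirce_decomposition R U E F"
proof (intro peirce_decomposition.intro U_unital_algebra peirce_decomposition_axioms.intro, goal_cases)
  case (8 x)
  then obtain a where x: "x = GMat a \<zero>\<^bsub>M\<^esub> \<zero>\<^bsub>N\<^esub> \<zero>\<^bsub>B\<^esub>" "a \<in> carrier A" by (auto simp: blocks)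
  have "a = \<zero>\<^bsub>A\<^esub>" using 8 x by (intro faithful_A) (auto simp: blocks)
  then show ?case using x by simp
next
  case (9 x)
  then obtain b where x: "x = GMat \<zero>\<^bsub>A\<^esub> \<zero>\<^bsub>M\<^esub> \<zero>\<^bsub>N\<^esub> b" "b \<in> carrier B" by (auto simp: blocks)
  have "b = \<zero>\<^bsub>B\<^esub>" using 9 x by (intro faithful_B) (auto simp: blocks)
  then show ?case using x by simp
qed simp_all

text \<open>Commuting with \<open>E\<close> forces both off-diagonal entries to vanish, so a central matrix agrees with
  its two diagonal projections.\<close>

lemma center_U_diagonal:
  assumes "z \<in> center U"
  obtains a b where "z = GMat a \<zero>\<^bsub>M\<^esub> \<zero>\<^bsub>N\<^esub> b" "a \<in> carrier A" "b \<in> carrier B"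
proof -
  have z: "z \<in> carrier U" "z \<otimes>\<^bsub>U\<^esub> E = E \<otimes>\<^bsub>U\<^esub> z"
    using assms by (auto simp: center_def)
  then show ?thesis using that by (auto elim!: U_cases)
qed

end

section \<open>Lie triple centralizers of generalized matrix algebras\<close>

theorem corollary3p4:
  fixes R :: "('r, 'x) ring_scheme"
    and A :: "('r, 'a, 'y) module_scheme"
    and B :: "('r, 'b, 'z) module_scheme"
    and M :: "('r, 'm, 'a, 'b, 'v) bimodule_scheme"
    and N :: "('r, 'n, 'b, 'a, 'w) bimodule_scheme"
    and mn :: "'m \<Rightarrow> 'n \<Rightarrow> 'a"
    and nm :: "'n \<Rightarrow> 'm \<Rightarrow> 'b"
    and \<phi> :: "('a, 'm, 'n, 'b) gmat \<Rightarrow> ('a, 'm, 'n, 'b) gmat"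
  assumes morita: "unital_morita_context R A B M N mn nm"
    and faithful_A: "\<And>a. \<lbrakk>a \<in> carrier A; \<forall>m\<in>carrier M. lact M a m = \<zero>\<^bsub>M\<^esub>;
        \<forall>n\<in>carrier N. ract N n a = \<zero>\<^bsub>N\<^esub>\<rbrakk> \<Longrightarrow> a = \<zero>\<^bsub>A\<^esub>"
    and faithful_B: "\<And>b. \<lbrakk>b \<in> carrier B; \<forall>m\<in>carrier M. ract M m b = \<zero>\<^bsub>M\<^esub>;
        \<forall>n\<in>carrier N. lact N b n = \<zero>\<^bsub>N\<^esub>\<rbrakk> \<Longrightarrow> b = \<zero>\<^bsub>B\<^esub>"
    and cond_i: "piB ` center (gen_matrix_algebra A B M N mn nm) = center B \<or>
        triple_commutators R A = carrier A"
    and cond_ii: "piA ` center (gen_matrix_algebra A B M N mn nm) = center A \<or>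
        triple_commutators R B = carrier B"
    and lin: "linear_map R (gen_matrix_algebra A B M N mn nm) (gen_matrix_algebra A B M N mn nm) \<phi>"
  shows "lie_triple_centralizer R (gen_matrix_algebra A B M N mn nm) \<phi> \<longleftrightarrow>
    proper_lie_triple_centralizer R (gen_matrix_algebra A B M N mn nm) \<phi>"
proof
  interpret unital_morita_context R A B M N mn nm by (rule morita)
  interpret U: unital_algebra R U by (rule U_unital_algebra)
  show "lie_triple_centralizer R U \<phi>" if "proper_lie_triple_centralizer R U \<phi>"
    using that by (rule U.proper_imp_lie_triple_centralizer)
  assume ltc: "lie_triple_centralizer R U \<phi>"
  interpret P: lie_triple_peirce R U E F \<phi>
    by (intro lie_triple_peirce.intro U_peirce lie_triple_peirce_axioms.intro ltc faithful_A faithful_B)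
  interpret S: lie_triple_peirce R U F E \<phi> by (rule P.lie_triple_swap)
  \<comment> \<open>The two conditions are used separately, one for each far corner.\<close>
  show "proper_lie_triple_centralizer R U \<phi>"
  proof (rule P.far_corners_central_imp_proper)
    fix x assume x: "x \<in> peirce_block U E E"
    show "\<exists>z\<in>center U. F \<otimes>\<^bsub>U\<^esub> \<phi> x = F \<otimes>\<^bsub>U\<^esub> z"
      using cond_i
    proof
      assume c: "piB ` center U = center B"
      obtain b where b: "F \<otimes>\<^bsub>U\<^esub> \<phi> x = GMat \<zero>\<^bsub>A\<^esub> \<zero>\<^bsub>M\<^esub> \<zero>\<^bsub>N\<^esub> b" "b \<in> carrier B"
        using P.far_corner(1)[OF x] by (auto simp: blocks)
      have "b \<otimes>\<^bsub>B\<^esub> b' = b' \<otimes>\<^bsub>B\<^esub> b" if "b' \<in> carrier B" for b'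
        using P.far_corner(2)[OF x, of "GMat \<zero>\<^bsub>A\<^esub> \<zero>\<^bsub>M\<^esub> \<zero>\<^bsub>N\<^esub> b'"] that b by (auto simp: blocks)
      then have "b \<in> center B" using b by (simp add: center_def)
      then obtain z where z: "z \<in> center U" "b = piB z" using c by blast
      then have "F \<otimes>\<^bsub>U\<^esub> \<phi> x = F \<otimes>\<^bsub>U\<^esub> z" using b by (auto elim!: center_U_diagonal)
      then show ?thesis using z by blast
    next
      assume span: "triple_commutators R A = carrier A"
      obtain a where a: "x = GMat a \<zero>\<^bsub>M\<^esub> \<zero>\<^bsub>N\<^esub> \<zero>\<^bsub>B\<^esub>" "a \<in> carrier A" using x by (auto simp: blocks)
      have "F \<otimes>\<^bsub>U\<^esub> \<phi> x = \<zero>\<^bsub>U\<^esub>"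
        unfolding a(1)
        by (rule P.far_corner_zero[OF M.A.unital_algebra_axioms span _ _ _ a(2)])
          (auto simp: linear_map_def blocks)
      then show ?thesis using U.zero_center U.r_null[OF P.f_closed] by metis
    qed
  next
    fix x assume x: "x \<in> peirce_block U F F"
    show "\<exists>z\<in>center U. E \<otimes>\<^bsub>U\<^esub> \<phi> x = E \<otimes>\<^bsub>U\<^esub> z"
      using cond_ii
    proof
      assume c: "piA ` center U = center A"
      obtain a where a: "E \<otimes>\<^bsub>U\<^esub> \<phi> x = GMat a \<zero>\<^bsub>M\<^esub> \<zero>\<^bsub>N\<^esub> \<zero>\<^bsub>B\<^esub>" "a \<in> carrier A"
        using S.far_corner(1)[OF x] by (auto simp: blocks)
      have "a \<otimes>\<^bsub>A\<^esub> a' = a' \<otimes>\<^bsub>A\<^esub> a" if "a' \<in> carrier A" for a'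
        using S.far_corner(2)[OF x, of "GMat a' \<zero>\<^bsub>M\<^esub> \<zero>\<^bsub>N\<^esub> \<zero>\<^bsub>B\<^esub>"] that a by (auto simp: blocks)
      then have "a \<in> center A" using a by (simp add: center_def)
      then obtain z where z: "z \<in> center U" "a = piA z" using c by blast
      then have "E \<otimes>\<^bsub>U\<^esub> \<phi> x = E \<otimes>\<^bsub>U\<^esub> z" using a by (auto elim!: center_U_diagonal)
      then show ?thesis using z by blast
    next
      assume span: "triple_commutators R B = carrier B"
      obtain b where b: "x = GMat \<zero>\<^bsub>A\<^esub> \<zero>\<^bsub>M\<^esub> \<zero>\<^bsub>N\<^esub> b" "b \<in> carrier B" using x by (auto simp: blocks)
      have "E \<otimes>\<^bsub>U\<^esub> \<phi> x = \<zero>\<^bsub>U\<^esub>"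
        unfolding b(1)
        by (rule S.far_corner_zero[OF M.B.unital_algebra_axioms span _ _ _ b(2)])
          (auto simp: linear_map_def blocks)
      then show ?thesis using U.zero_center U.r_null[OF P.e_closed] by metis
    qed
  qed
qed

end
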